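(* Let $d \ge 1$ be an integer and let $0 < p < q < \infty$. Then there exists a constant $C = C_{d,p,q} > 0$, depending only on $d,p,q$, such that, for all integers $N \ge 1$ and all $\mu \in \mathcal P_{q,\mathrm w}(\mathbb R^d)$, \[ e_{N;d,p}(\mu) \le C\, \mathcal M_{q,\mathrm w}(\mu)^{1/q} \times \begin{cases} \max\{N^{-1/p+1/q},\, N^{-1/d}\} & \text{if } d \ne \frac{pq}{q-p},\\ N^{-1/d} \big(\log(1+N)\big)^{1/p} & \text{if } d = \frac{pq}{q-p}. \end{cases} \]
   Context: $\mathcal P(\mathbb R^d)$ is the set of Borel probability measures on $\mathbb R^d$, and $|\cdot|$ is the Euclidean norm. For $0 < p < \infty$, $\mathcal P_p(\mathbb R^d) := \{\mu \in \mathcal P(\mathbb R^d) : \int |x|^p \mu(dx) < \infty\}$. For $0<q<\infty$, \[ \mathcal M_{q,\mathrm w}(\mu) := \sup_{\lambda \ge 0} \lambda^q\, \mu(\{x \in \mathbb R^d : |x| \ge \lambda\}), \qquad \mathcal P_{q,\mathrm w}(\mathbb R^d) := \{\mu \in \mathcal P(\mathbb R^d) : \mathcal M_{q,\mathrm w}(\mu) < \infty\}. \] (For $p<q$ one has $\mathcal P_{q,\mathrm w}(\mathbb R^d) \subseteq \mathcal P_p(\mathbb R^d)$.) For $0<p<\infty$ and $\mu,\nu \in \mathcal P_p(\mathbb R^d)$, \[ \mathcal W_p(\mu,\nu) := \inf_{\gamma \in \Gamma(\mu,\nu)} \left( \iint_{\mathbb R^d\times\mathbb R^d} |x-y|^p\,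 \gamma(dx,dy) \right)^{1/p}, \] where $\Gamma(\mu,\nu)$ is the set of probability measures on $\mathbb R^d \times \mathbb R^d$ with first marginal $\mu$ and second marginal $\nu$ (values $p<1$ are allowed, with the same formula). For an integer $N \ge 1$, \[ e_{N;d,p}(\mu) := \inf_{(x_1,\dots,x_N) \in (\mathbb R^d)^N} \mathcal W_p\Big(\mu, \frac1N \sum_{i=1}^N \delta_{x_i}\Big). \] *)

theory Defs
  imports "HOL-Probability.Probability"
begin

definition borel_probs :: "(real ^ 'n) measure set" where
  "borel_probs = {\<mu>. prob_space \<mu> \<and> sets \<mu> = sets borel}"

text \<open>Powers of extended nonnegative reals with a positive exponent \<open>a\<close>, so that \<open>\<infinity> ^ a = \<infinity>\<close>.\<close>

definition ennreal_powr :: "ennreal \<Rightarrow> real \<Rightarrow> ennreal" where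
  "ennreal_powr x a = (if x = \<infinity> then \<infinity> else ennreal (enn2real x powr a))"

definition weak_moment :: "real \<Rightarrow> (real ^ 'n) measure \<Rightarrow> ennreal" where
  "weak_moment q \<mu> = (SUP t\<in>{0..}. ennreal (t powr q) * emeasure \<mu> {x. t \<le> norm x})"

definition weak_probs :: "real \<Rightarrow> (real ^ 'n) measure set" where
  "weak_probs q = {\<mu> \<in> borel_probs. weak_moment q \<mu> < \<infinity>}"

definition couplings ::
  "(real ^ 'n) measure \<Rightarrow> (real ^ 'n) measure \<Rightarrow> ((real ^ 'n) \<times> (real ^ 'n)) measure set" where
  "couplings \<mu> \<nu> = {\<gamma>. prob_space \<gamma> \<and> sets \<gamma> = sets (borel \<Otimes>\<^sub>M borel) \<and>
     distr \<gamma> borel fst = \<mu> \<and> distr \<gamma> borel snd = \<nu>}"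

text \<open>The infimum is taken in \<open>[0, \<infinity>]\<close>, so no finiteness of moments is needed for the definition
  to make sense; on measures with finite \<open>p\<close>-th moment the value is finite.\<close>

definition wasserstein :: "real \<Rightarrow> (real ^ 'n) measure \<Rightarrow> (real ^ 'n) measure \<Rightarrow> ennreal" where
  "wasserstein p \<mu> \<nu> = (INF \<gamma>\<in>couplings \<mu> \<nu>.
     ennreal_powr (\<integral>\<^sup>+ (x, y). ennreal (norm (x - y) powr p) \<partial>\<gamma>) (1 / p))"

text \<open>The measure \<open>(1/N) (\<delta>\<^bsub>x 1\<^esub> + \<dots> + \<delta>\<^bsub>x N\<^esub>)\<close> as the image of the uniform
  distribution on \<open>{1..N}\<close>; only the values of \<open>x\<close> on \<open>{1..N}\<close> matter.\<close>

definition empirical :: "nat \<Rightarrow> (nat \<Rightarrow> real ^ 'n) \<Rightarrow> (real ^ 'n) measure" where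
  "empirical N x = distr (uniform_count_measure {1..N}) borel x"

lemma emeasure_empirical:
  fixes x :: "nat \<Rightarrow> real ^ 'n"
  assumes "N \<ge> 1" and A: "A \<in> sets borel"
  shows "emeasure (empirical N x) A = ennreal (1 / real N) * (\<Sum>i=1..N. emeasure (return borel (x i)) A)"
proof -
  have "emeasure (empirical N x) A = emeasure (uniform_count_measure {1..N}) (x -` A \<inter> {1..N})"
    unfolding empirical_def using A
    by (subst emeasure_distr) (auto simp: space_uniform_count_measure sets_uniform_count_measure measurable_def)
  also have "\<dots> = ennreal (real (card (x -` A \<inter> {1..N})) / real N)"
    by (subst emeasure_uniform_count_measure) auto
  also have "real (card (x -` A \<inter> {1..N})) = (\<Sum>i=1..N. indicator A (x i))"
    by (simp add: indicator_def sum.If_cases Int_commute vimage_def)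
  also have "ennreal ((\<Sum>i=1..N. indicator A (x i)) / real N) =
      ennreal (1 / real N) * (\<Sum>i=1..N. emeasure (return borel (x i)) A)"
    using A by (simp add: ennreal_mult[symmetric] sum_nonneg ennreal_indicator[symmetric]
        del: ennreal_indicator)
  finally show ?thesis .
qed

definition quantization_error :: "nat \<Rightarrow> real \<Rightarrow> (real ^ 'n) measure \<Rightarrow> ennreal" where
  "quantization_error N p \<mu> = (INF x. wasserstein p \<mu> (empirical N x))"

end

(* Order R^d by the dyadic shell R 2^(j-1) <= |x| < R 2^j and, inside a shell, by a Morton
   (Z-order) code of depth N, so that every dyadic cell of every level occupies an interval
   in the order. Cut mu into N consecutive pieces of mass 1/N and place one atom for each
   piece, in its first cell. If a piece lies inside one cell of level k, the mass it has there
   moves at most the diameter of that cell, about R 2^(j-k). Each cell meets at most two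
   pieces which leave it, so the mass in shell j of pieces not confined to a cell of level k
   is at most min (mu (shell j)) (2 * 2^(dk) / N). With mu (shell j) <= C 2^(-qj), for R^q at
   least the weak moment, the cost is at most a constant times
     R^p (sum over k and j of 2^(p(j-k)) min (2^(-qj)) (2^(dk) / N)).
   The sum over j is comparable to min 1 ((2^(dk) / N)^(1 - p/q)), and the sum over k is
   geometric on both sides of 2^(dk) = N unless d (1 - p/q) = p, where it is constant below. *)

theory Submission
  imports Defs
begin

text \<open>Each atom must carry exactly 1/N, while the masses of the cells are arbitrary reals, so
  distributing atoms cell by cell would require rounding at every level. Cutting along one linear
  order settles all levels at once. The position of the atom guards against heavy tails: when a
  piece runs over several shells, its inner mass must not travel to a far shell. With the atom
  first, no point moves to a larger code, so the move is at most twice the outer radius of the shell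
  of the point itself, and it is weighed against the mass of that shell. Points with the same code
  are not ordered among themselves and may even form an atom of the measure; such a class is divided
  in fixed proportions, which leads to a plan with weights instead of a map. Finite depth makes the
  codes natural numbers; its price is a term of order 2^(-pN), which is below N^(-p/d).\<close>

section \<open>Couplings from weighted transport plans\<close>

text \<open>\<open>f l\<close> is the density with respect to \<open>\<mu>\<close> of the mass sent
  to \<open>X l\<close>, so the weights \<open>f l x\<close> at the points \<open>(x, X l)\<close>
  form a coupling. Their sum is prescribed only almost everywhere because \<open>plan\<close>
  vanishes on codes of mass zero.\<close>

lemma wasserstein_le_plan:
  fixes \<mu> :: "(real ^ 'n) measure" and X :: "nat \<Rightarrow> real ^ 'n" and f :: "nat \<Rightarrow> real ^ 'n \<Rightarrow> ennreal"
  assumes \<mu>: "\<mu> \<in> borel_probs" and N: "N \<ge> 1"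
    and f_meas: "\<And>l. f l \<in> borel_measurable borel"
    and f_sum: "AE x in \<mu>. (\<Sum>l=1..N. f l x) = 1"
    and f_int: "\<And>l. l \<in> {1..N} \<Longrightarrow> (\<integral>\<^sup>+ x. f l x \<partial>\<mu>) = ennreal (1 / real N)"
  shows "wasserstein p \<mu> (empirical N X) \<le>
    ennreal_powr (\<Sum>l=1..N. \<integral>\<^sup>+ x. f l x * ennreal (norm (x - X l) powr p) \<partial>\<mu>) (1 / p)"
proof -
  interpret prob_space \<mu> using \<mu> by (simp add: borel_probs_def)
  have sets_\<mu>[simp, measurable_cong]: "sets \<mu> = sets borel" using \<mu> by (simp add: borel_probs_def)
  then have space_\<mu>[simp]: "space \<mu> = UNIV" using sets_eq_imp_space_eq[of \<mu> borel] by simp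
  define Q where "Q = count_space {1..N} \<Otimes>\<^sub>M \<mu>"
  have f_meas'[measurable]: "(\<lambda>(l, x). f l x) \<in> borel_measurable Q"
    unfolding Q_def using f_meas by (intro measurable_pair_measure_countable1) auto
  have map_meas[measurable]: "(\<lambda>(l, x). (x, X l)) \<in> Q \<rightarrow>\<^sub>M (borel \<Otimes>\<^sub>M borel)"
    unfolding Q_def by (intro measurable_pair_measure_countable1) auto
  define \<gamma> where "\<gamma> = distr (density Q (\<lambda>(l, x). f l x)) (borel \<Otimes>\<^sub>M borel) (\<lambda>(l, x). (x, X l))"
  \<comment> \<open>Both marginals and the cost are instances of this formula.\<close>
  have int_\<gamma>: "(\<integral>\<^sup>+ z. h z \<partial>\<gamma>) = (\<Sum>l=1..N. \<integral>\<^sup>+ x. f l x * h (x, X l) \<partial>\<mu>)"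
    if h[measurable]: "h \<in> borel_measurable (borel \<Otimes>\<^sub>M borel)" for h
  proof -
    have "(\<integral>\<^sup>+ z. h z \<partial>\<gamma>) = (\<integral>\<^sup>+ (l, x). f l x * h (x, X l) \<partial>Q)"
      unfolding \<gamma>_def
      using measurable_compose[OF map_meas h] f_meas' map_meas
      by (subst nn_integral_distr, simp_all add: split_beta', subst nn_integral_density)
        (simp_all add: split_beta')
    also have "\<dots> = (\<integral>\<^sup>+ l. (\<integral>\<^sup>+ x. f l x * h (x, X l) \<partial>\<mu>) \<partial>count_space {1..N})"
    proof -
      have "(\<lambda>(l, x). f l x * h (x, X l)) \<in> borel_measurable (count_space {1..N} \<Otimes>\<^sub>M \<mu>)"
        using f_meas by (intro measurable_pair_measure_countable1) auto
      from nn_integral_fst[OF this] show ?thesis unfolding Q_def by simp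
    qed
    also have "\<dots> = (\<Sum>l=1..N. \<integral>\<^sup>+ x. f l x * h (x, X l) \<partial>\<mu>)"
      by (simp add: nn_integral_count_space_finite)
    finally show ?thesis .
  qed
  have fst_\<gamma>: "emeasure \<gamma> (fst -` A) = emeasure \<mu> A" if A[measurable]: "A \<in> sets borel" for A
  proof -
    have "emeasure \<gamma> (fst -` A) = (\<integral>\<^sup>+ z. indicator A (fst z) \<partial>\<gamma>)"
    proof -
      have "fst -` A \<in> sets \<gamma>"
        unfolding \<gamma>_def using measurable_sets[OF measurable_fst A, of borel] by (simp add: space_pair_measure)
      then have "emeasure \<gamma> (fst -` A) = (\<integral>\<^sup>+ z. indicator (fst -` A) z \<partial>\<gamma>)" by simp
      then show ?thesis by (simp add: indicator_def)
    qed
    also have "\<dots> = (\<Sum>l=1..N. \<integral>\<^sup>+ x. f l x * indicator A x \<partial>\<mu>)"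
      by (subst int_\<gamma>) auto
    also have "\<dots> = (\<integral>\<^sup>+ x. (\<Sum>l=1..N. f l x * indicator A x) \<partial>\<mu>)"
      using f_meas by (subst nn_integral_sum) auto
    also have "\<dots> = (\<integral>\<^sup>+ x. indicator A x \<partial>\<mu>)"
      using f_sum by (intro nn_integral_cong_AE) (auto simp: sum_distrib_right[symmetric])
    finally show ?thesis by simp
  qed
  have snd_\<gamma>: "emeasure \<gamma> (snd -` A) = emeasure (empirical N X) A" if A[measurable]: "A \<in> sets borel" for A
  proof -
    have "emeasure \<gamma> (snd -` A) = (\<integral>\<^sup>+ z. indicator A (snd z) \<partial>\<gamma>)"
    proof -
      have "snd -` A \<in> sets \<gamma>"
        unfolding \<gamma>_def using measurable_sets[OF measurable_snd A, of borel] by (simp add: space_pair_measure)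
      then have "emeasure \<gamma> (snd -` A) = (\<integral>\<^sup>+ z. indicator (snd -` A) z \<partial>\<gamma>)" by simp
      then show ?thesis by (simp add: indicator_def)
    qed
    also have "\<dots> = (\<Sum>l=1..N. \<integral>\<^sup>+ x. f l x * indicator A (X l) \<partial>\<mu>)"
      by (subst int_\<gamma>) auto
    also have "\<dots> = (\<Sum>l=1..N. ennreal (1 / real N) * indicator A (X l))"
      using f_meas f_int by (intro sum.cong) (auto simp: nn_integral_multc)
    also have "\<dots> = emeasure (empirical N X) A"
      using N by (simp add: emeasure_empirical sum_distrib_left)
    finally show ?thesis .
  qed
  have [simp]: "sets \<gamma> = sets (borel \<Otimes>\<^sub>M borel)" "space \<gamma> = UNIV"
    by (auto simp: \<gamma>_def space_pair_measure)
  have "\<gamma> \<in> couplings \<mu> (empirical N X)"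
    unfolding couplings_def
  proof (safe intro!: measure_eqI)
    show "prob_space \<gamma>"
      using fst_\<gamma>[of UNIV] emeasure_space_1 by (intro prob_spaceI) simp
    fix A assume "A \<in> sets (distr \<gamma> borel fst)"
    then show "emeasure (distr \<gamma> borel fst) A = emeasure \<mu> A"
      using fst_\<gamma>[of A] by (simp add: emeasure_distr measurable_cong_sets[of \<gamma> "borel \<Otimes>\<^sub>M borel" borel borel])
  next
    fix A assume "A \<in> sets (distr \<gamma> borel snd)"
    then show "emeasure (distr \<gamma> borel snd) A = emeasure (empirical N X) A"
      using snd_\<gamma>[of A] by (simp add: emeasure_distr measurable_cong_sets[of \<gamma> "borel \<Otimes>\<^sub>M borel" borel borel])
  qed (auto simp: empirical_def)
  then have "wasserstein p \<mu> (empirical N X) \<le>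
     ennreal_powr (\<integral>\<^sup>+ (x, y). ennreal (norm (x - y) powr p) \<partial>\<gamma>) (1 / p)"
    unfolding wasserstein_def by (rule INF_lower)
  also have "(\<integral>\<^sup>+ (x, y). ennreal (norm (x - y) powr p) \<partial>\<gamma>) =
     (\<Sum>l=1..N. \<integral>\<^sup>+ x. f l x * ennreal (norm (x - X l) powr p) \<partial>\<mu>)"
    by (subst int_\<gamma>) auto
  finally show ?thesis .
qed

section \<open>Cutting the unit interval into equal pieces\<close>

text \<open>The length of the part of the \<open>l\<close>-th interval \<open>[(l - 1) / N, l / N]\<close> lying to the left of \<open>t\<close>.\<close>

definition cut :: "nat \<Rightarrow> nat \<Rightarrow> real \<Rightarrow> real" where
  "cut N l t = min t (real l / real N) - min t ((real l - 1) / real N)"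

lemma cut_mono: "cut N l s \<le> cut N l t" if "s \<le> t"
proof -
  have "(real l - 1) / real N \<le> real l / real N" by (simp add: divide_right_mono)
  with that show ?thesis by (auto simp: cut_def min_def)
qed

lemma cut_zero: "1 \<le> l \<Longrightarrow> cut N l 0 = 0"
  by (simp add: cut_def)

lemma cut_one: "l \<in> {1..N} \<Longrightarrow> cut N l 1 = 1 / real N"
  by (simp add: cut_def min_def field_simps)

lemma sum_cut: "0 \<le> t \<Longrightarrow> t \<le> 1 \<Longrightarrow> 1 \<le> N \<Longrightarrow> (\<Sum>l=1..N. cut N l t) = t"
proof -
  assume t: "0 \<le> t" "t \<le> 1" "1 \<le> N"
  have "(\<Sum>l=1..n. cut N l t) = min t (real n / real N) - min t 0" for n
    by (induction n) (auto simp: cut_def)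
  from this[of N] t show ?thesis by simp
qed

lemma cut_diff_le:
  assumes "s \<le> t"
  shows "cut N l t - cut N l s \<le> 1 / real N"
proof -
  have "(min t b - min t a) - (min s b - min s a) \<le> e" if "b = a + e" "0 \<le> e" for a b e :: real
    using that assms by linarith
  from this[of "real l / real N" "(real l - 1) / real N" "1 / real N"]
  show ?thesis by (simp add: cut_def diff_divide_distrib)
qed

lemma cut_lessD:
  assumes "cut N l s < cut N l t"
  shows "s < real l / real N" "(real l - 1) / real N < t"
proof -
  have "(real l - 1) / real N \<le> real l / real N" by (simp add: divide_right_mono)
  with assms show "s < real l / real N" "(real l - 1) / real N < t"
    by (auto simp: cut_def min_def split: if_splits)
qed

text \<open>The \<open>l\<close>-th interval is not contained in \<open>[s, t]\<close>.\<close>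

definition split_by :: "nat \<Rightarrow> real \<Rightarrow> real \<Rightarrow> nat \<Rightarrow> bool" where
  "split_by N s t l \<longleftrightarrow> \<not> (s \<le> (real l - 1) / real N \<and> real l / real N \<le> t)"

text \<open>A piece that shares positive length with \<open>[s, t]\<close> without being contained
  in it has \<open>s\<close> or \<open>t\<close> in its interior. \<open>H u\<close> collects the
  pieces around \<open>u\<close>; interiors are disjoint, so there is at most one, and it
  contributes at most \<open>1 / real N\<close>.\<close>

lemma split_cuts_le:
  assumes "s \<le> t" "1 \<le> N"
  shows "(\<Sum>l | l \<in> {1..N} \<and> split_by N s t l. cut N l t - cut N l s) \<le> 2 / real N"
proof -
  define H where "H u = {l \<in> {1..N}. (real l - 1) / real N < u \<and> u < real l / real N}" for u
  have card: "card (H u) \<le> 1" for u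
  proof -
    have "l = l'" if "l \<in> H u" "l' \<in> H u" for l l'
    proof -
      from that have "real l - 1 < u * real N" "u * real N < real l" "real l' - 1 < u * real N" "u * real N < real l'"
        using assms by (auto simp: H_def field_simps)
      then show ?thesis by linarith
    qed
    moreover have "finite (H u)" by (simp add: H_def)
    ultimately show ?thesis by (metis One_nat_def card_le_Suc0_iff_eq)
  qed
  let ?S = "{l. l \<in> {1..N} \<and> split_by N s t l}"
  have fin: "finite (H s \<union> H t)" "finite ?S" by (auto simp: H_def)
  have "cut N l t - cut N l s = 0" if l: "l \<in> ?S - (H s \<union> H t)" for l
  proof (rule ccontr)
    assume "cut N l t - cut N l s \<noteq> 0"
    then have "cut N l s < cut N l t" using cut_mono[OF assms(1), of N l] by simp
    from cut_lessD[OF this] l show False by (auto simp: H_def split_by_def)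
  qed
  then have "(\<Sum>l\<in>?S. cut N l t - cut N l s) = (\<Sum>l\<in>?S \<inter> (H s \<union> H t). cut N l t - cut N l s)"
    using fin by (intro sum.mono_neutral_right) auto
  also have "\<dots> \<le> (\<Sum>l\<in>?S \<inter> (H s \<union> H t). 1 / real N)"
    using cut_diff_le[OF assms(1)] by (intro sum_mono) auto
  also have "\<dots> \<le> (\<Sum>l\<in>H s \<union> H t. 1 / real N)"
    using fin by (intro sum_mono2) auto
  also have "\<dots> = real (card (H s \<union> H t)) / real N" by simp
  also have "\<dots> \<le> 2 / real N"
    using card[of s] card[of t] card_Un_le[of "H s" "H t"] by (intro divide_right_mono) auto
  finally show ?thesis .
qed

section \<open>The transport plan induced by a code\<close>

locale coded_prob_space = prob_space M for M :: "'a measure" +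
  fixes g :: "'a \<Rightarrow> nat" and N :: nat
  assumes code_measurable[measurable]: "g \<in> M \<rightarrow>\<^sub>M count_space UNIV"
    and N_pos: "1 \<le> N"
begin

text \<open>With the strict inequality, code \<open>m\<close> occupies the interval from
  \<open>F m\<close> to \<open>F (Suc m)\<close>, and the first one starts at 0.\<close>

definition F :: "nat \<Rightarrow> real" where "F m = prob {x \<in> space M. g x < m}"

text \<open>With \<open>F\<close> as distribution function of the code, \<open>w m l\<close> is the mass with code \<open>m\<close> sent to atom \<open>l\<close>.
  Blocks of \<open>b\<close> consecutive codes, that is the classes of \<open>m div b\<close>, play the role of coarser cells.\<close>

definition w :: "nat \<Rightarrow> nat \<Rightarrow> real" where "w m l = cut N l (F (Suc m)) - cut N l (F m)"

text \<open>All points with one code are split in the same proportions; on a code of mass zero the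
  quotient is 0.\<close>

definition plan :: "nat \<Rightarrow> 'a \<Rightarrow> real" where "plan l x = w (g x) l / (F (Suc (g x)) - F (g x))"

definition first_code :: "nat \<Rightarrow> nat" where "first_code l = (LEAST m. 0 < w m l)"

text \<open>The block of \<open>m\<close> starts at the code \<open>b * (m div b)\<close>. Pieces
  that miss the block count as bad too, but there \<open>w m l = 0\<close>.\<close>

definition bad :: "nat \<Rightarrow> nat \<Rightarrow> nat \<Rightarrow> bool" where
  "bad b m l \<longleftrightarrow> split_by N (F (b * (m div b))) (F (b * (m div b) + b)) l"

lemma F_mono: "m \<le> n \<Longrightarrow> F m \<le> F n"
  unfolding F_def by (intro finite_measure_mono) auto

lemma F_zero: "F 0 = 0"
  by (simp add: F_def)

lemma F_nonneg: "0 \<le> F m"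
  by (simp add: F_def)

lemma F_le_one: "F m \<le> 1"
  by (simp add: F_def)

lemma F_diff:
  assumes "m \<le> n"
  shows "F n - F m = prob {x \<in> space M. m \<le> g x \<and> g x < n}"
proof -
  have "{x \<in> space M. m \<le> g x \<and> g x < n} = {x \<in> space M. g x < n} - {x \<in> space M. g x < m}"
    by auto
  moreover have "{x \<in> space M. g x < m} \<subseteq> {x \<in> space M. g x < n}"
    using assms by auto
  ultimately show ?thesis
    using finite_measure_Diff[of "{x \<in> space M. g x < n}" "{x \<in> space M. g x < m}"] by (simp add: F_def)
qed

lemma F_Suc_diff: "F (Suc m) - F m = prob {x \<in> space M. g x = m}"
proof -
  have "{x \<in> space M. m \<le> g x \<and> g x < Suc m} = {x \<in> space M. g x = m}" by auto
  with F_diff[of m "Suc m"] show ?thesis by simp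
qed

lemma F_tendsto: "F \<longlonglongrightarrow> 1"
proof -
  have "(\<lambda>m. prob {x \<in> space M. g x < m}) \<longlonglongrightarrow> prob (\<Union>m. {x \<in> space M. g x < m})"
    by (intro finite_Lim_measure_incseq) (auto simp: incseq_def)
  also have "(\<Union>m. {x \<in> space M. g x < m}) = space M" by auto
  finally show ?thesis by (simp add: F_def[abs_def] prob_space)
qed

lemma w_nonneg: "0 \<le> w m l"
  using cut_mono[OF F_mono[of m "Suc m"]] by (simp add: w_def)

lemma sum_cut_F: "(\<Sum>l=1..N. cut N l (F m)) = F m"
  by (rule sum_cut[OF F_nonneg F_le_one N_pos])

lemma sum_w: "(\<Sum>l=1..N. w m l) = F (Suc m) - F m"
  unfolding w_def sum_subtractf sum_cut_F ..

lemma w_sums: "l \<in> {1..N} \<Longrightarrow> (\<lambda>m. w m l) sums (1 / real N)"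
proof -
  assume l: "l \<in> {1..N}"
  have "(\<lambda>m. cut N l (F m)) \<longlonglongrightarrow> cut N l 1"
    unfolding cut_def by (intro tendsto_intros F_tendsto)
  from telescope_sums[OF this] l show ?thesis by (simp add: w_def F_zero cut_zero cut_one)
qed

text \<open>The shares of a code are nonnegative and add up to its mass, so they vanish when the
  division is by zero.\<close>

lemma w_mult_div: "l \<in> {1..N} \<Longrightarrow> w m l / (F (Suc m) - F m) * (F (Suc m) - F m) = w m l"
proof -
  assume l: "l \<in> {1..N}"
  have "w m l \<le> (\<Sum>l=1..N. w m l)" using l w_nonneg by (intro member_le_sum) auto
  then have "F (Suc m) - F m = 0 \<Longrightarrow> w m l = 0" using w_nonneg[of m l] sum_w[of m] by simp
  then show ?thesis by fastforce
qed

text \<open>There are only countably many codes, so those of mass zero are negligible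
  together.\<close>

lemma AE_mass_pos: "AE x in M. 0 < F (Suc (g x)) - F (g x)"
proof -
  have "AE x in M. g x = m \<longrightarrow> 0 < F (Suc m) - F m" for m
  proof (cases "F (Suc m) - F m = 0")
    case True
    then have "AE x in M. g x \<noteq> m"
      by (intro AE_I[of _ _ "{x \<in> space M. g x = m}"]) (auto simp: F_Suc_diff emeasure_eq_measure)
    then show ?thesis by eventually_elim simp
  next
    case False
    then show ?thesis using F_mono[of m "Suc m"] by simp
  qed
  then have "AE x in M. \<forall>m. g x = m \<longrightarrow> 0 < F (Suc m) - F m"
    unfolding AE_all_countable by blast
  then show ?thesis by eventually_elim blast
qed

lemma nn_integral_code:
  assumes "\<And>m. 0 \<le> \<phi> m"
  shows "(\<integral>\<^sup>+ x. ennreal (\<phi> (g x)) \<partial>M) = (\<Sum>m. ennreal (\<phi> m * (F (Suc m) - F m)))"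
proof -
  have "(\<integral>\<^sup>+ x. ennreal (\<phi> (g x)) \<partial>M) = (\<integral>\<^sup>+ x. (\<Sum>m. ennreal (\<phi> m) * indicator {x \<in> space M. g x = m} x) \<partial>M)"
  proof (intro nn_integral_cong)
    fix x assume x: "x \<in> space M"
    have "(\<Sum>m. ennreal (\<phi> m) * indicator {x \<in> space M. g x = m} x) =
       (\<Sum>m\<in>{g x}. ennreal (\<phi> m) * indicator {x \<in> space M. g x = m} x)"
      by (intro suminf_finite) auto
    then show "ennreal (\<phi> (g x)) = (\<Sum>m. ennreal (\<phi> m) * indicator {x \<in> space M. g x = m} x)"
      using x by simp
  qed
  also have "\<dots> = (\<Sum>m. ennreal (\<phi> m) * emeasure M {x \<in> space M. g x = m})"
    by (subst nn_integral_suminf) (auto simp: nn_integral_cmult)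
  finally show ?thesis
    using assms by (simp add: F_Suc_diff emeasure_eq_measure ennreal_mult)
qed

lemma plan_nonneg: "0 \<le> plan l x"
  using F_mono[of "g x" "Suc (g x)"] by (simp add: plan_def w_nonneg)

lemma plan_measurable[measurable]: "plan l \<in> borel_measurable M"
  unfolding plan_def by measurable

lemma plan_sum: "AE x in M. (\<Sum>l=1..N. ennreal (plan l x)) = 1"
  using AE_mass_pos
proof eventually_elim
  fix x assume "0 < F (Suc (g x)) - F (g x)"
  then have "(\<Sum>l=1..N. plan l x) = 1"
    unfolding plan_def sum_divide_distrib[symmetric] sum_w by simp
  then show "(\<Sum>l=1..N. ennreal (plan l x)) = 1" by (simp add: plan_nonneg)
qed

lemma plan_integral:
  assumes "l \<in> {1..N}"
  shows "(\<integral>\<^sup>+ x. ennreal (plan l x) \<partial>M) = ennreal (1 / real N)"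
proof -
  have "(\<integral>\<^sup>+ x. ennreal (plan l x) \<partial>M) = (\<Sum>m. ennreal (w m l))"
    unfolding plan_def using F_mono
    by (subst nn_integral_code) (simp_all only: w_mult_div[OF assms], simp add: w_nonneg)
  also have "\<dots> = ennreal (1 / real N)"
    using w_sums[OF assms] by (intro suminf_ennreal_eq w_nonneg)
  finally show ?thesis .
qed

lemma first_code_pos: "l \<in> {1..N} \<Longrightarrow> 0 < w (first_code l) l"
proof -
  assume l: "l \<in> {1..N}"
  have "\<exists>m. 0 < w m l"
  proof (rule ccontr)
    assume "\<nexists>m. 0 < w m l"
    then have "w m l = 0" for m using w_nonneg[of m l] by (metis order_le_less)
    then have "(\<lambda>_. 0::real) sums (1 / real N)" using w_sums[OF l] by simp
    then have "(0::real) = 1 / real N" by (rule sums_unique2[OF sums_zero])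
    then show False using N_pos by simp
  qed
  then show ?thesis unfolding first_code_def by (rule LeastI_ex)
qed

lemma first_code_least: "0 < w m l \<Longrightarrow> first_code l \<le> m"
  unfolding first_code_def by (rule Least_le)

text \<open>The interval of \<open>n\<close> overlaps the piece in positive length, and the piece
  lies in the interval of the block. The resulting comparisons of values of \<open>F\<close> are
  strict, as they must be: \<open>F\<close> may be constant on long stretches, and only strict
  inequalities carry over to codes.\<close>

lemma not_bad_imp_same_block:
  assumes "\<not> bad b m l" "0 < b" "0 < w n l"
  shows "n div b = m div b"
proof -
  from assms(3) have *: "F n < real l / real N" "(real l - 1) / real N < F (Suc n)"
    using cut_lessD[of N l "F n" "F (Suc n)"] by (auto simp: w_def)
  from assms(1) have "F (b * (m div b)) \<le> (real l - 1) / real N" "real l / real N \<le> F (b * (m div b) + b)"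
    by (auto simp: bad_def split_by_def)
  with * have "F (b * (m div b)) < F (Suc n)" "F n < F (b * (m div b) + b)" by linarith+
  then have "b * (m div b) < Suc n" "n < b * (m div b) + b"
    using F_mono by (meson not_le)+
  then show ?thesis using assms(2)
    by (intro div_nat_eqI) (auto simp: mult.commute)
qed

text \<open>A number need not occur as a code, but the first code of a piece has positive mass and
  is therefore attained.\<close>

lemma exists_first_point:
  "\<exists>X. \<forall>l\<in>{1..N}. X l \<in> space M \<and> g (X l) = first_code l"
proof (intro bchoice ballI)
  fix l assume l: "l \<in> {1..N}"
  have "F (Suc (first_code l)) - F (first_code l) \<noteq> 0"
    using first_code_pos[OF l] by (auto simp: w_def)
  then have "{x \<in> space M. g x = first_code l} \<noteq> {}" by (metis F_Suc_diff measure_empty)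
  then show "\<exists>x. x \<in> space M \<and> g x = first_code l" by auto
qed

lemma sum_w_interval: "s \<le> t \<Longrightarrow> (\<Sum>m=s..<t. w m l) = cut N l (F t) - cut N l (F s)"
  unfolding w_def by (rule sum_Suc_diff')

text \<open>Badness is constant on a block, so summing over its codes telescopes to the length each
  piece shares with the block. Summing these lengths over all pieces gives the mass of the block,
  over the split ones at most \<open>2 / real N\<close>.\<close>

lemma sum_bad_block_le:
  assumes "0 < b"
  shows "(\<Sum>m\<in>{i*b..<i*b+b}. \<Sum>l | l \<in> {1..N} \<and> bad b m l. w m l) \<le> min (F (i*b+b) - F (i*b)) (2 / real N)"
proof -
  let ?S = "{l. l \<in> {1..N} \<and> split_by N (F (i*b)) (F (i*b+b)) l}"
  have div: "m div b = i" if "m \<in> {i*b..<i*b+b}" for m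
    using that by (intro div_nat_eqI) (auto simp: mult.commute)
  have "(\<Sum>m\<in>{i*b..<i*b+b}. \<Sum>l | l \<in> {1..N} \<and> bad b m l. w m l) = (\<Sum>m\<in>{i*b..<i*b+b}. \<Sum>l\<in>?S. w m l)"
    by (intro sum.cong) (auto simp: bad_def div mult.commute)
  also have "\<dots> = (\<Sum>l\<in>?S. cut N l (F (i*b+b)) - cut N l (F (i*b)))"
    by (subst sum.swap) (simp add: sum_w_interval)
  finally have eq: "(\<Sum>m\<in>{i*b..<i*b+b}. \<Sum>l | l \<in> {1..N} \<and> bad b m l. w m l) = \<dots>" .
  have "\<dots> \<le> (\<Sum>l=1..N. cut N l (F (i*b+b)) - cut N l (F (i*b)))"
    using cut_mono[OF F_mono[of "i*b" "i*b+b"]] by (intro sum_mono2) auto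
  also have "\<dots> = F (i*b+b) - F (i*b)"
    unfolding sum_subtractf sum_cut_F ..
  finally show ?thesis
    using split_cuts_le[OF F_mono[of "i*b" "i*b+b"] N_pos] eq by simp
qed

end

section \<open>The cost of the plan, by blocks and levels\<close>

lemma sum_blocks:
  fixes f :: "nat \<Rightarrow> 'b::comm_monoid_add"
  shows "(\<Sum>i=s..<s+c. sum f {i*b..<i*b+b}) = sum f {s*b..<(s+c)*b}"
proof (induction c)
  case (Suc c)
  have "sum f {s*b..<(s+c)*b} + sum f {(s+c)*b..<(s+c)*b+b} = sum f {s*b..<(s+c)*b+b}"
    by (intro sum.atLeastLessThan_concat) (auto simp: algebra_simps)
  with Suc show ?case by (simp add: algebra_simps)
qed simp

lemma suminf_blocks_ennreal:
  fixes f :: "nat \<Rightarrow> ennreal"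
  assumes "0 < b"
  shows "(\<Sum>j. sum f {j*b..<j*b+b}) = (\<Sum>m. f m)"
proof -
  have "(\<lambda>n. sum f {..<n}) \<longlonglongrightarrow> (\<Sum>m. f m)" by (rule summable_LIMSEQ) (rule summableI)
  from LIMSEQ_subseq_LIMSEQ[OF this, of "\<lambda>n. n * b"] assms
  have "(\<lambda>n. sum f {..<n * b}) \<longlonglongrightarrow> (\<Sum>m. f m)" by (simp add: strict_mono_def o_def)
  then have "(\<lambda>j. sum f {j*b..<j*b+b}) sums (\<Sum>m. f m)"
    by (simp add: sums_def sum.nat_group)
  then show ?thesis by (rule sums_unique[symmetric])
qed

context coded_prob_space
begin

lemma sum_F_Suc_diff: "s \<le> t \<Longrightarrow> (\<Sum>m=s..<t. F (Suc m) - F m) = F t - F s"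
  by (rule sum_Suc_diff')

lemma F_block_diff:
  assumes "0 < b"
  shows "F (j * b + b) - F (j * b) = prob {x \<in> space M. g x div b = j}"
proof -
  have "m div b = j \<longleftrightarrow> j \<le> m div b \<and> m div b < Suc j" for m by auto
  then have "m div b = j \<longleftrightarrow> j * b \<le> m \<and> m < j * b + b" for m
    using assms by (simp add: less_eq_div_iff_mult_less_eq div_less_iff_less_mult add.commute)
  with F_diff[of "j * b" "j * b + b"] show ?thesis by simp
qed

text \<open>A shell is a block of \<open>B^K\<close> codes and splits into \<open>c = B^k\<close>
  blocks of \<open>b = B^(K-k)\<close> codes, the cells of level \<open>k\<close>. A sum of minima
  is at most the minimum of the sums.\<close>

lemma sum_bad_level_le:
  assumes "0 < B" "k \<le> K"
  shows "(\<Sum>m\<in>{j*B^K..<j*B^K+B^K}. \<Sum>l | l \<in> {1..N} \<and> bad (B^(K-k)) m l. w m l)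
    \<le> min (prob {x \<in> space M. g x div B^K = j}) (2 * real B ^ k / real N)"
proof -
  define b where "b = B ^ (K - k)"
  define c where "c = B ^ k"
  have b: "0 < b" using assms by (simp add: b_def)
  have bc: "B ^ K = c * b" using assms by (simp add: b_def c_def flip: power_add)
  have block: "{j*B^K..<j*B^K+B^K} = {(j*c)*b..<(j*c+c)*b}"
    unfolding bc by (simp add: algebra_simps)
  have "(\<Sum>m\<in>{j*B^K..<j*B^K+B^K}. \<Sum>l | l \<in> {1..N} \<and> bad b m l. w m l)
    = (\<Sum>i=j*c..<j*c+c. \<Sum>m\<in>{i*b..<i*b+b}. \<Sum>l | l \<in> {1..N} \<and> bad b m l. w m l)"
    unfolding block by (rule sum_blocks[symmetric])
  also have "\<dots> \<le> (\<Sum>i=j*c..<j*c+c. min (F (i*b+b) - F (i*b)) (2 / real N))"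
    by (intro sum_mono sum_bad_block_le b)
  finally have le: "(\<Sum>m\<in>{j*B^K..<j*B^K+B^K}. \<Sum>l | l \<in> {1..N} \<and> bad b m l. w m l) \<le> \<dots>" .
  have "(\<Sum>i=j*c..<j*c+c. min (F (i*b+b) - F (i*b)) (2 / real N)) \<le> (\<Sum>i=j*c..<j*c+c. F (i*b+b) - F (i*b))"
    by (intro sum_mono) simp
  also have "\<dots> = (\<Sum>i=j*c..<j*c+c. \<Sum>m=i*b..<i*b+b. F (Suc m) - F m)"
    by (simp add: sum_F_Suc_diff)
  also have "\<dots> = (\<Sum>m=(j*c)*b..<(j*c+c)*b. F (Suc m) - F m)" by (rule sum_blocks)
  also have "\<dots> = F ((j*c+c)*b) - F ((j*c)*b)" by (intro sum_F_Suc_diff) simp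
  also have "\<dots> = F (j * (c * b) + c * b) - F (j * (c * b))" by (simp add: algebra_simps)
  also have "\<dots> = prob {x \<in> space M. g x div (c * b) = j}"
    using assms by (intro F_block_diff) (simp add: bc[symmetric])
  finally have 1: "(\<Sum>i=j*c..<j*c+c. min (F (i*b+b) - F (i*b)) (2 / real N)) \<le> \<dots>" .
  have "(\<Sum>i=j*c..<j*c+c. min (F (i*b+b) - F (i*b)) (2 / real N)) \<le> (\<Sum>i=j*c..<j*c+c. 2 / real N)"
    by (intro sum_mono) simp
  also have "\<dots> = 2 * real B ^ k / real N" by (simp add: c_def)
  finally show ?thesis using 1 le by (simp add: b_def[symmetric] bc)
qed

text \<open>Only the first bad level needs to be paid for; charging every bad level makes the cost
  additive, so that each level can be summed separately. The index is shifted: failure at level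
  \<open>k\<close> costs \<open>a k\<close>, the diameter at level \<open>k - 1\<close>, with
  \<open>a 0\<close> for moves between shells. The last term is for pieces confined even at level
  \<open>K\<close>.\<close>

definition level_cost :: "nat \<Rightarrow> nat \<Rightarrow> (nat \<Rightarrow> nat \<Rightarrow> real) \<Rightarrow> nat \<Rightarrow> nat \<Rightarrow> real" where
  "level_cost B K a m l = (\<Sum>k\<le>K. if bad (B^(K-k)) m l then a k (m div B^K) else 0) + a (Suc K) (m div B^K)"

text \<open>At the level before the first bad one the piece is confined, so \<open>x\<close> and the
  atom share that cell. If already level 0 is bad, minimality of \<open>first_code\<close> gives
  \<open>g y \<le> g x\<close>, and \<open>root\<close> applies.\<close>

lemma le_level_cost:
  fixes \<delta> :: "'a \<Rightarrow> 'a \<Rightarrow> real"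
  assumes B: "0 < B" and a: "\<And>k j. 0 \<le> a k j"
    and root: "\<And>x y. g y \<le> g x \<Longrightarrow> \<delta> x y \<le> a 0 (g x div B^K)"
    and cell: "\<And>x y k. k \<le> K \<Longrightarrow> g x div B^(K-k) = g y div B^(K-k) \<Longrightarrow> \<delta> x y \<le> a (Suc k) (g x div B^K)"
    and y: "g y = first_code l" and l: "l \<in> {1..N}" and pos: "0 < w (g x) l"
  shows "\<delta> x y \<le> level_cost B K a (g x) l"
proof (cases "\<exists>k. k \<le> K \<and> bad (B^(K-k)) (g x) l")
  case True
  define k where "k = (LEAST k. k \<le> K \<and> bad (B^(K-k)) (g x) l)"
  have k: "k \<le> K" "bad (B^(K-k)) (g x) l" using LeastI_ex[OF True] by (auto simp: k_def)
  have "\<delta> x y \<le> a k (g x div B^K)"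
  proof (cases k)
    case 0
    then show ?thesis using root y first_code_least[OF pos] by simp
  next
    case (Suc k')
    then have "k' \<le> K" "\<not> bad (B^(K-k')) (g x) l"
      using k not_less_Least[of k' "\<lambda>k. k \<le> K \<and> bad (B^(K-k)) (g x) l"] by (auto simp: k_def)
    then have "g y div B^(K-k') = g x div B^(K-k')"
      unfolding y using B by (intro not_bad_imp_same_block[OF _ _ first_code_pos[OF l]]) simp_all
    then show ?thesis using cell[OF \<open>k' \<le> K\<close>] Suc by simp
  qed
  also have "\<dots> = (if bad (B^(K-k)) (g x) l then a k (g x div B^K) else 0)" using k by simp
  also have "\<dots> \<le> (\<Sum>k\<le>K. if bad (B^(K-k)) (g x) l then a k (g x div B^K) else 0)"
    using k a by (intro member_le_sum) auto
  finally show ?thesis using a[of "Suc K" "g x div B^K"] by (simp add: level_cost_def)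
next
  case False
  then have "\<not> bad (B^(K-K)) (g x) l" by blast
  then have "g y div B^(K-K) = g x div B^(K-K)"
    unfolding y using B by (intro not_bad_imp_same_block[OF _ _ first_code_pos[OF l]]) simp_all
  then have "\<delta> x y \<le> a (Suc K) (g x div B^K)" using cell[of K x y] by simp
  moreover have "0 \<le> (\<Sum>k\<le>K. if bad (B^(K-k)) (g x) l then a k (g x div B^K) else 0)"
    using a by (intro sum_nonneg) auto
  ultimately show ?thesis by (simp add: level_cost_def)
qed

lemma level_cost_nonneg: "(\<And>k j. 0 \<le> a k j) \<Longrightarrow> 0 \<le> level_cost B K a m l"
  unfolding level_cost_def by (intro add_nonneg_nonneg sum_nonneg) auto

text \<open>On a block of \<open>B^K\<close> codes the shell number \<open>m div B^K\<close> is
  fixed, so each \<open>a k j\<close> factors out and leaves the bad mass of level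
  \<open>k\<close>.\<close>

lemma sum_level_cost_block_le:
  assumes B: "0 < B" and a: "\<And>k j. 0 \<le> a k j"
  shows "(\<Sum>m=j*B^K..<j*B^K+B^K. \<Sum>l=1..N. w m l * level_cost B K a m l) \<le>
    (\<Sum>k\<le>K. a k j * min (prob {x \<in> space M. g x div B^K = j}) (2 * real B ^ k / real N))
      + a (Suc K) j * prob {x \<in> space M. g x div B^K = j}"
proof -
  let ?I = "{j*B^K..<j*B^K+B^K}"
  let ?S = "\<lambda>k m. {l. l \<in> {1..N} \<and> bad (B^(K-k)) m l}"
  have div: "m div B^K = j" if "m \<in> ?I" for m
    using that by (intro div_nat_eqI) (auto simp: mult.commute)
  have "(\<Sum>m\<in>?I. \<Sum>l=1..N. w m l * level_cost B K a m l)
     = (\<Sum>m\<in>?I. \<Sum>l=1..N. (\<Sum>k\<le>K. a k j * (if bad (B^(K-k)) m l then w m l else 0)) + a (Suc K) j * w m l)"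
  proof (intro sum.cong refl)
    fix m l assume "m \<in> ?I"
    show "w m l * level_cost B K a m l
      = (\<Sum>k\<le>K. a k j * (if bad (B^(K-k)) m l then w m l else 0)) + a (Suc K) j * w m l"
      unfolding level_cost_def div[OF \<open>m \<in> ?I\<close>] distrib_left sum_distrib_left
      by (intro arg_cong2[where f = "(+)"] sum.cong) (simp_all add: mult.commute)
  qed
  also have "\<dots> = (\<Sum>m\<in>?I. \<Sum>l=1..N. \<Sum>k\<le>K. a k j * (if bad (B^(K-k)) m l then w m l else 0))
       + a (Suc K) j * (\<Sum>m\<in>?I. \<Sum>l=1..N. w m l)"
    unfolding sum.distrib sum_distrib_left ..
  finally have eq: "(\<Sum>m\<in>?I. \<Sum>l=1..N. w m l * level_cost B K a m l) = \<dots>" .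
  have "(\<Sum>m\<in>?I. \<Sum>l=1..N. \<Sum>k\<le>K. a k j * (if bad (B^(K-k)) m l then w m l else 0))
      = (\<Sum>m\<in>?I. \<Sum>k\<le>K. \<Sum>l=1..N. a k j * (if bad (B^(K-k)) m l then w m l else 0))"
    by (intro sum.cong refl sum.swap)
  also have "\<dots> = (\<Sum>k\<le>K. \<Sum>m\<in>?I. \<Sum>l=1..N. a k j * (if bad (B^(K-k)) m l then w m l else 0))"
    by (rule sum.swap)
  also have "\<dots> = (\<Sum>k\<le>K. a k j * (\<Sum>m\<in>?I. \<Sum>l\<in>?S k m. w m l))"
    unfolding sum_distrib_left[symmetric]
    by (simp only: sum.inter_filter[OF finite_atLeastAtMost])
  also have "\<dots> \<le> (\<Sum>k\<le>K. a k j * min (prob {x \<in> space M. g x div B^K = j}) (2 * real B ^ k / real N))"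
    by (intro sum_mono mult_left_mono sum_bad_level_le a B) auto
  finally have "(\<Sum>m\<in>?I. \<Sum>l=1..N. \<Sum>k\<le>K. a k j * (if bad (B^(K-k)) m l then w m l else 0)) \<le> \<dots>" .
  moreover have "(\<Sum>m\<in>?I. \<Sum>l=1..N. w m l) = F (j*B^K+B^K) - F (j*B^K)"
    unfolding sum_w by (rule sum_F_Suc_diff) simp
  moreover have "\<dots> = prob {x \<in> space M. g x div B^K = j}"
    using B by (intro F_block_diff) simp
  ultimately show ?thesis unfolding eq by simp
qed

text \<open>Geometry enters through two bounds only: \<open>a 0 j\<close> for a move from shell
  \<open>j\<close> to a code that is not larger, \<open>a (Suc k) j\<close> for a move inside a cell
  of level \<open>k\<close>.\<close>

lemma plan_cost_le:
  fixes \<delta> :: "'a \<Rightarrow> 'a \<Rightarrow> real"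
  assumes B: "0 < B" and a: "\<And>k j. 0 \<le> a k j"
    and root: "\<And>x y. g y \<le> g x \<Longrightarrow> \<delta> x y \<le> a 0 (g x div B^K)"
    and cell: "\<And>x y k. k \<le> K \<Longrightarrow> g x div B^(K-k) = g y div B^(K-k) \<Longrightarrow> \<delta> x y \<le> a (Suc k) (g x div B^K)"
    and X: "\<And>l. l \<in> {1..N} \<Longrightarrow> g (X l) = first_code l"
  shows "(\<Sum>l=1..N. \<integral>\<^sup>+ x. ennreal (plan l x * \<delta> x (X l)) \<partial>M) \<le>
    (\<Sum>j. ennreal ((\<Sum>k\<le>K. a k j * min (prob {x \<in> space M. g x div B^K = j}) (2 * real B ^ k / real N))
      + a (Suc K) j * prob {x \<in> space M. g x div B^K = j}))"
proof -
  let ?c = "level_cost B K a"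
  have c_nonneg: "0 \<le> ?c m l" for m l using a by (rule level_cost_nonneg)
  have "(\<integral>\<^sup>+ x. ennreal (plan l x * \<delta> x (X l)) \<partial>M) \<le> (\<Sum>m. ennreal (w m l * ?c m l))"
    if l: "l \<in> {1..N}" for l
  proof -
    let ?\<phi> = "\<lambda>m. w m l / (F (Suc m) - F m) * ?c m l"
    have "(\<integral>\<^sup>+ x. ennreal (plan l x * \<delta> x (X l)) \<partial>M) \<le> (\<integral>\<^sup>+ x. ennreal (?\<phi> (g x)) \<partial>M)"
    proof (intro nn_integral_mono ennreal_leI)
      fix x
      show "plan l x * \<delta> x (X l) \<le> ?\<phi> (g x)"
      proof (cases "w (g x) l = 0")
        case False
        then have "0 < w (g x) l" using w_nonneg[of "g x" l] by simp
        then have "\<delta> x (X l) \<le> ?c (g x) l"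
          by (intro le_level_cost[where a = a and \<delta> = \<delta>] B a root cell X l)
        from mult_left_mono[OF this plan_nonneg[of l x]] show ?thesis by (simp add: plan_def)
      qed (simp add: plan_def)
    qed
    also have "\<dots> = (\<Sum>m. ennreal (?\<phi> m * (F (Suc m) - F m)))"
      using F_mono w_nonneg c_nonneg by (intro nn_integral_code) simp
    also have "(\<lambda>m. ?\<phi> m * (F (Suc m) - F m)) = (\<lambda>m. w m l * ?c m l)"
    proof
      fix m
      have "?\<phi> m * (F (Suc m) - F m) = w m l / (F (Suc m) - F m) * (F (Suc m) - F m) * ?c m l"
        by (simp only: ac_simps)
      then show "?\<phi> m * (F (Suc m) - F m) = w m l * ?c m l" unfolding w_mult_div[OF l] .
    qed
    finally show ?thesis .
  qed
  then have "(\<Sum>l=1..N. \<integral>\<^sup>+ x. ennreal (plan l x * \<delta> x (X l)) \<partial>M) \<le> (\<Sum>l=1..N. \<Sum>m. ennreal (w m l * ?c m l))"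
    by (rule sum_mono)
  also have "\<dots> = (\<Sum>m. \<Sum>l=1..N. ennreal (w m l * ?c m l))"
    by (intro suminf_sum[symmetric] summableI)
  also have "\<dots> = (\<Sum>m. ennreal (\<Sum>l=1..N. w m l * ?c m l))"
    using w_nonneg c_nonneg by (simp add: sum_ennreal)
  also have "\<dots> = (\<Sum>j. \<Sum>m=j*B^K..<j*B^K+B^K. ennreal (\<Sum>l=1..N. w m l * ?c m l))"
    using B by (intro suminf_blocks_ennreal[symmetric]) simp
  also have "\<dots> = (\<Sum>j. ennreal (\<Sum>m=j*B^K..<j*B^K+B^K. \<Sum>l=1..N. w m l * ?c m l))"
    using w_nonneg c_nonneg by (simp add: sum_ennreal sum_nonneg)
  also have "\<dots> \<le> (\<Sum>j. ennreal ((\<Sum>k\<le>K. a k j * min (prob {x \<in> space M. g x div B^K = j}) (2 * real B ^ k / real N))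
      + a (Suc K) j * prob {x \<in> space M. g x div B^K = j}))"
    by (intro suminf_le summableI ennreal_leI sum_level_cost_block_le a B)
  finally show ?thesis .
qed

end

section \<open>Dyadic shells and codes of cells\<close>

text \<open>Shell 0 is the whole ball of radius \<open>R\<close> and not an annulus.\<close>

definition shell :: "real \<Rightarrow> real ^ 'n \<Rightarrow> nat" where
  "shell R x = (LEAST j. norm x < R * 2 ^ j)"

lemma norm_less_shell: "0 < R \<Longrightarrow> norm x < R * 2 ^ shell R x"
proof -
  assume R: "0 < R"
  obtain j where "norm x / R < 2 ^ j" using real_arch_pow[of 2 "norm x / R"] by auto
  then have "norm x < R * 2 ^ j" using R by (simp add: field_simps)
  then show ?thesis unfolding shell_def by (rule LeastI)
qed

lemma shell_Suc_le_norm: "shell R x = Suc j \<Longrightarrow> R * 2 ^ j \<le> norm x"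
  using not_less_Least[of j "\<lambda>j. norm x < R * 2 ^ j"] unfolding shell_def by simp

lemma shell_measurable[measurable]: "shell R \<in> borel \<rightarrow>\<^sub>M count_space UNIV"
  unfolding shell_def by measurable

text \<open>Affine coordinates on the cube circumscribed to the shell of \<open>x\<close>, with values in \<open>[0, 1)\<close>.\<close>

definition shell_coord :: "real \<Rightarrow> real ^ 'n \<Rightarrow> 'n \<Rightarrow> real" where
  "shell_coord R x i = (x $ i + R * 2 ^ shell R x) / (2 * R * 2 ^ shell R x)"

lemma shell_coord_measurable[measurable]: "(\<lambda>x :: real ^ 'n. shell_coord R x i) \<in> borel_measurable borel"
proof -
  have [measurable]: "(\<lambda>x :: real ^ 'n. 2 ^ shell R x :: real) \<in> borel_measurable borel"
    by (rule measurable_compose[OF shell_measurable]) simp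
  have [measurable]: "(\<lambda>x::real ^ 'n. x $ i) \<in> borel_measurable borel"
    by (intro borel_measurable_continuous_onI continuous_intros)
  show ?thesis unfolding shell_coord_def by measurable
qed

lemma floor_shell_coord: "0 < R \<Longrightarrow> \<lfloor>shell_coord R x i\<rfloor> = 0"
proof -
  assume R: "0 < R"
  have "\<bar>x $ i\<bar> < R * 2 ^ shell R x"
    using norm_less_shell[OF R, of x] component_le_norm_cart[of x i] by linarith
  moreover have "0 < R * 2 ^ shell R x" using R by simp
  ultimately have "0 \<le> shell_coord R x i" "shell_coord R x i < 1"
    unfolding shell_coord_def by (auto simp: field_simps)
  then show ?thesis by linarith
qed

text \<open>The parity of \<open>\<lfloor>2 * t\<rfloor>\<close> is the next binary digit of
  \<open>t\<close>; this recursion rebuilds a cell from its digits.\<close>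

lemma floor_double: "\<lfloor>2 * t\<rfloor> = 2 * \<lfloor>t\<rfloor> + (if odd \<lfloor>2 * t\<rfloor> then 1 else 0)" for t :: real
proof -
  have "\<lfloor>2 * t\<rfloor> = 2 * \<lfloor>t\<rfloor> \<or> \<lfloor>2 * t\<rfloor> = 2 * \<lfloor>t\<rfloor> + 1" by linarith
  then show ?thesis by auto
qed

text \<open>A set of coordinates stands for a vector of binary digits. An arbitrary enumeration
  suffices: the argument uses the nesting of the cells and the order of the shells.\<close>

definition subset_index :: "'n::finite set \<Rightarrow> nat" where
  "subset_index = (SOME h. bij_betw h UNIV {0..<2 ^ CARD('n)})"

lemma subset_index_bij: "bij_betw (subset_index :: 'n::finite set \<Rightarrow> nat) UNIV {0..<2 ^ CARD('n)}"
proof -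
  have "\<exists>h. bij_betw h (UNIV :: 'n set set) {0..<card (UNIV :: 'n set set)}"
    by (rule ex_bij_betw_finite_nat) simp
  moreover have "card (UNIV :: 'n set set) = 2 ^ CARD('n)"
    using card_Pow[of "UNIV :: 'n set"] by simp
  ultimately show ?thesis unfolding subset_index_def by (metis (mono_tags, lifting) someI_ex)
qed

lemma subset_index_less: "subset_index (S :: 'n::finite set) < 2 ^ CARD('n)"
  using subset_index_bij[where 'n = 'n] by (auto simp: bij_betw_def)

lemma subset_index_eq_iff: "subset_index S = subset_index T \<longleftrightarrow> S = T"
  using subset_index_bij by (auto simp: bij_betw_def inj_on_def)

text \<open>One base-\<open>2 ^ d\<close> digit per level, holding the next binary digit of every coordinate; dropping the last
  digits therefore gives the code of the enclosing coarser cell.\<close>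

primrec cell_code :: "real \<Rightarrow> nat \<Rightarrow> real ^ 'n \<Rightarrow> nat" where
  "cell_code R 0 x = shell R x"
| "cell_code R (Suc k) x = subset_index {i. odd \<lfloor>2 ^ Suc k * shell_coord R x i\<rfloor>} + cell_code R k x * 2 ^ CARD('n)"

lemma cell_code_Suc_div: "cell_code R (Suc k) (x :: real ^ 'n) div 2 ^ CARD('n) = cell_code R k x"
  by (simp add: subset_index_less)

lemma cell_code_div: "k \<le> K \<Longrightarrow> cell_code R K (x :: real ^ 'n) div (2 ^ CARD('n)) ^ (K - k) = cell_code R k x"
proof (induction K)
  case (Suc K)
  show ?case
  proof (cases "k = Suc K")
    case False
    with Suc have "k \<le> K" by simp
    with Suc.IH cell_code_Suc_div[of R K x] show ?thesis
      by (simp only: Suc_diff_le power_Suc div_mult2_eq)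
  qed simp
qed simp

lemma cell_code_measurable[measurable]: "(cell_code R k :: real ^ 'n \<Rightarrow> nat) \<in> borel \<rightarrow>\<^sub>M count_space UNIV"
proof (induction k)
  case 0
  have "(cell_code R 0 :: real ^ 'n \<Rightarrow> nat) = shell R" by (simp add: fun_eq_iff)
  then show ?case by simp
next
  case (Suc k)
  have D: "(\<lambda>x :: real ^ 'n. {i. odd \<lfloor>2 ^ Suc k * shell_coord R x i\<rfloor>}) \<in> borel \<rightarrow>\<^sub>M count_space UNIV"
  \<comment> \<open>The target is finite, so preimages of single sets are enough.\<close>
  proof (subst measurable_count_space_eq2, safe)
    fix S :: "'n set"
    have "(\<lambda>x :: real ^ 'n. {i. odd \<lfloor>2 ^ Suc k * shell_coord R x i\<rfloor>}) -` {S} \<inter> space borel =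
       {x \<in> space borel. \<forall>i\<in>UNIV. odd \<lfloor>2 ^ Suc k * shell_coord R x i\<rfloor> \<longleftrightarrow> i \<in> S}"
      by auto
    moreover have "\<dots> \<in> sets borel" by measurable
    ultimately show "(\<lambda>x :: real ^ 'n. {i. odd \<lfloor>2 ^ Suc k * shell_coord R x i\<rfloor>}) -` {S} \<inter> space borel \<in> sets borel"
      by simp
  qed auto
  \<comment> \<open>The previous code is frozen at \<open>m\<close>; its countably many values are
    then put together.\<close>
  have "(\<lambda>x :: real ^ 'n. subset_index {i. odd \<lfloor>2 ^ Suc k * shell_coord R x i\<rfloor>} + m * 2 ^ CARD('n))
      \<in> borel \<rightarrow>\<^sub>M count_space UNIV" for m
    by (rule measurable_compose[OF D]) simp
  from measurable_compose_countable[OF this Suc] show ?case by simp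
qed

text \<open>Division strips the last digit, so equal codes agree at all coarser levels, and each
  digit fixes the next floor. The induction starts from coordinates in [0, 1), whose floors are
  0.\<close>

lemma cell_code_eqD:
  fixes x y :: "real ^ 'n"
  assumes "0 < R" "cell_code R k x = cell_code R k y"
  shows "shell R x = shell R y \<and> (\<forall>i. \<lfloor>2 ^ k * shell_coord R x i\<rfloor> = \<lfloor>2 ^ k * shell_coord R y i\<rfloor>)"
  using assms(2)
proof (induction k)
  case 0
  then show ?case using assms(1) by (simp add: floor_shell_coord)
next
  case (Suc k)
  let ?u = "\<lambda>k x i. \<lfloor>2 ^ k * shell_coord R x i\<rfloor>"
  have eq: "cell_code R k x = cell_code R k y" using Suc.prems cell_code_Suc_div by metis
  with Suc.prems have "{i. odd (?u (Suc k) x i)} = {i. odd (?u (Suc k) y i)}"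
    by (simp del: power_Suc add: subset_index_eq_iff)
  then have odd: "odd (?u (Suc k) x i) \<longleftrightarrow> odd (?u (Suc k) y i)" for i by blast
  have step: "?u (Suc k) z i = 2 * ?u k z i + (if odd (?u (Suc k) z i) then 1 else 0)" for z i
    using floor_double[of "2 ^ k * shell_coord R z i"] by (simp only: power_Suc mult.assoc)
  have "?u k x i = ?u k y i" for i using Suc.IH[OF eq] by blast
  then have "2 * ?u k x i + (if odd (?u (Suc k) x i) then 1 else 0) =
      2 * ?u k y i + (if odd (?u (Suc k) y i) then 1 else 0)" for i
    by (simp only: odd)
  then have "?u (Suc k) x i = ?u (Suc k) y i" for i
    by (rule trans[OF step trans[OF _ step[symmetric]]])
  with Suc.IH[OF eq] show ?case by blast
qed

text \<open>Equal floors put each pair of coordinates within one side length of the cell; bounding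
  the Euclidean norm by the l1 norm gives the factor \<open>CARD('n)\<close>.\<close>

lemma cell_code_eq_imp_norm_diff_le:
  fixes x y :: "real ^ 'n"
  assumes R: "0 < R" and eq: "cell_code R k x = cell_code R k y"
  shows "norm (x - y) \<le> real CARD('n) * (2 * R * 2 ^ shell R x / 2 ^ k)"
proof -
  let ?s = "2 * R * 2 ^ shell R x"
  have s: "0 < ?s" using R by simp
  have "\<bar>(x - y) $ i\<bar> \<le> ?s / 2 ^ k" for i
  proof -
    from cell_code_eqD[OF assms] have "\<lfloor>2 ^ k * shell_coord R x i\<rfloor> = \<lfloor>2 ^ k * shell_coord R y i\<rfloor>" by blast
    then have "\<bar>2 ^ k * shell_coord R x i - 2 ^ k * shell_coord R y i\<bar> \<le> 1" by linarith
    also have "2 ^ k * shell_coord R x i - 2 ^ k * shell_coord R y i = 2 ^ k * ((x - y) $ i) / ?s"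
    proof -
      have "shell R y = shell R x" using cell_code_eqD[OF assms] by simp
      then have "shell_coord R x i - shell_coord R y i = (x - y) $ i / ?s"
        by (simp add: shell_coord_def diff_divide_distrib[symmetric])
      then show ?thesis by (simp only: right_diff_distrib[symmetric] times_divide_eq_right)
    qed
    finally have "2 ^ k * \<bar>(x - y) $ i\<bar> / ?s \<le> 1"
      using R by (simp only: abs_mult abs_divide power_abs abs_numeral abs_of_pos)
    then have "2 ^ k * \<bar>(x - y) $ i\<bar> \<le> ?s" using s by (simp only: divide_le_eq_1_pos)
    then show ?thesis by (simp only: pos_le_divide_eq zero_less_power zero_less_numeral mult.commute)
  qed
  then have "(\<Sum>i\<in>UNIV. \<bar>(x - y) $ i\<bar>) \<le> (\<Sum>i\<in>(UNIV :: 'n set). ?s / 2 ^ k)" by (rule sum_mono)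
  with norm_le_l1_cart[of "x - y"] show ?thesis by simp
qed

section \<open>Geometric sums over shells and levels\<close>

lemma sum_power_le:
  fixes r :: real
  assumes "0 < r" "r < 1" "finite A"
  shows "sum (\<lambda>i. r ^ i) A \<le> 1 / (1 - r)"
proof -
  have "sum (\<lambda>i. r ^ i) A \<le> (\<Sum>i. r ^ i)"
    using assms by (intro sum_le_suminf summable_geometric) auto
  with assms show ?thesis by (simp add: suminf_geometric)
qed

lemma sum_powr_neg_le:
  fixes c :: real
  assumes "0 < c" "finite A"
  shows "(\<Sum>k\<in>A. 2 powr (- c * real k)) \<le> 1 / (1 - 2 powr (- c))"
proof -
  have "2 powr (- c * real k) = (2 powr (- c)) ^ k" for k
    by (simp add: powr_realpow[symmetric] powr_powr)
  moreover have "2 powr (- c) < (1::real)" using powr_less_mono[of "- c" 0 2] assms by simp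
  ultimately show ?thesis using sum_power_le[of "2 powr (- c)" A] assms by simp
qed

text \<open>Rounding \<open>\<tau>\<close> down changes each distance by at most 1, hence the factor
  \<open>2 powr c\<close>. On either side of the rounded value the distances are distinct natural
  numbers.\<close>

lemma sum_two_sided_geometric_le:
  fixes \<tau> c :: real
  assumes c: "0 < c" and A: "finite A"
  shows "(\<Sum>k\<in>A. 2 powr (- c * \<bar>real k - \<tau>\<bar>)) \<le> 2 powr c * (2 / (1 - 2 powr (- c)))"
proof -
  define n where "n = \<lfloor>\<tau>\<rfloor>"
  let ?h = "\<lambda>k. 2 powr (- c * real (nat \<bar>int k - n\<bar>))"
  have le: "2 powr (- c * \<bar>real k - \<tau>\<bar>) \<le> 2 powr c * ?h k" for k
  proof -
    have "\<bar>real k - of_int n\<bar> \<le> \<bar>real k - \<tau>\<bar> + 1" unfolding n_def by linarith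
    moreover have "real (nat \<bar>int k - n\<bar>) = \<bar>real k - of_int n\<bar>" by linarith
    ultimately have "c * real (nat \<bar>int k - n\<bar>) \<le> c * (\<bar>real k - \<tau>\<bar> + 1)" using c by simp
    then have "- c * \<bar>real k - \<tau>\<bar> \<le> c + (- c * real (nat \<bar>int k - n\<bar>))" by (simp add: algebra_simps)
    then have "2 powr (- c * \<bar>real k - \<tau>\<bar>) \<le> 2 powr (c + (- c * real (nat \<bar>int k - n\<bar>)))"
      by (intro powr_mono) auto
    then show ?thesis by (simp only: powr_add)
  qed
  have half: "sum ?h B \<le> 1 / (1 - 2 powr (- c))"
    if "finite B" "inj_on (\<lambda>k. nat \<bar>int k - n\<bar>) B" for B
    using sum_powr_neg_le[OF c, of "(\<lambda>k. nat \<bar>int k - n\<bar>) ` B"] that by (simp add: sum.reindex)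
  have "(\<Sum>k\<in>A. 2 powr (- c * \<bar>real k - \<tau>\<bar>)) \<le> 2 powr c * sum ?h A"
    unfolding sum_distrib_left by (intro sum_mono le)
  also have "sum ?h A = sum ?h {k \<in> A. int k \<le> n} + sum ?h {k \<in> A. \<not> int k \<le> n}"
    using A by (subst sum.union_disjoint[symmetric]) (auto intro!: sum.cong)
  also have "\<dots> \<le> 1 / (1 - 2 powr (- c)) + 1 / (1 - 2 powr (- c))"
    using A by (intro add_mono half) (auto simp: inj_on_def)
  finally show ?thesis by simp
qed

text \<open>The increasing and the decreasing sequence cross at \<open>\<tau>\<close>, with common
  value \<open>T powr (b / (a + b))\<close>; away from \<open>\<tau>\<close> the minimum decays at
  rate at least \<open>min a b\<close>.\<close>

lemma sum_min_powr_le: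
  fixes a b T :: real
  assumes a: "0 < a" and b: "0 < b" and T: "0 < T" and A: "finite A"
  shows "(\<Sum>k\<in>A. min (T * 2 powr (a * real k)) (2 powr (- b * real k)))
    \<le> 2 powr min a b * (2 / (1 - 2 powr (- min a b))) * T powr (b / (a + b))"
proof -
  define \<tau> where "\<tau> = - log 2 T / (a + b)"
  have "(a + b) * \<tau> = - log 2 T" using a b by (simp add: \<tau>_def)
  then have log_T: "log 2 T = - a * \<tau> - b * \<tau>" by (simp add: algebra_simps)
  have T_eq: "T = 2 powr (- a * \<tau> - b * \<tau>)"
    unfolding log_T[symmetric] using T by simp
  have T_powr: "T powr (b / (a + b)) = 2 powr (- b * \<tau>)"
  proof -
    have "(- a * \<tau> - b * \<tau>) * (b / (a + b)) = - b * \<tau>" using a b by (simp add: field_simps)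
    then show ?thesis by (subst T_eq) (simp only: powr_powr)
  qed
  have "min (T * 2 powr (a * real k)) (2 powr (- b * real k))
      \<le> 2 powr (- b * \<tau>) * 2 powr (- min a b * \<bar>real k - \<tau>\<bar>)" for k
  proof (cases "real k \<le> \<tau>")
    case True
    have "T * 2 powr (a * real k) = 2 powr (- b * \<tau> + - a * (\<tau> - real k))"
      by (subst T_eq) (simp add: powr_add[symmetric] algebra_simps)
    also have "\<dots> \<le> 2 powr (- b * \<tau> + - min a b * \<bar>real k - \<tau>\<bar>)"
      using True by (intro powr_mono) (auto intro!: mult_right_mono)
    also have "\<dots> = 2 powr (- b * \<tau>) * 2 powr (- min a b * \<bar>real k - \<tau>\<bar>)" by (rule powr_add)
    finally show ?thesis by (rule min.coboundedI1)
  next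
    case False
    have "2 powr (- b * real k) = 2 powr (- b * \<tau> + - b * (real k - \<tau>))"
      by (simp add: algebra_simps)
    also have "\<dots> \<le> 2 powr (- b * \<tau> + - min a b * \<bar>real k - \<tau>\<bar>)"
      using False by (intro powr_mono) (auto intro!: mult_right_mono)
    also have "\<dots> = 2 powr (- b * \<tau>) * 2 powr (- min a b * \<bar>real k - \<tau>\<bar>)" by (rule powr_add)
    finally show ?thesis by (rule min.coboundedI2)
  qed
  then have "(\<Sum>k\<in>A. min (T * 2 powr (a * real k)) (2 powr (- b * real k)))
      \<le> 2 powr (- b * \<tau>) * (\<Sum>k\<in>A. 2 powr (- min a b * \<bar>real k - \<tau>\<bar>))"
    unfolding sum_distrib_left by (intro sum_mono)
  also have "\<dots> \<le> 2 powr (- b * \<tau>) * (2 powr min a b * (2 / (1 - 2 powr (- min a b))))"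
    using a b A by (intro mult_left_mono sum_two_sided_geometric_le) auto
  finally show ?thesis unfolding T_powr by (simp only: ac_simps)
qed

text \<open>About \<open>\<kappa>\<close> terms take the full constant value, which is the origin of
  the logarithm in the critical case; the remaining ones decay geometrically.\<close>

lemma sum_min_const_powr_le:
  fixes p \<kappa> :: real
  assumes p: "0 < p" and \<kappa>: "0 \<le> \<kappa>" and A: "finite A"
  shows "(\<Sum>k\<in>A. min (2 powr (- p * \<kappa>)) (2 powr (- p * real k)))
    \<le> (\<kappa> + 1 + 1 / (1 - 2 powr (- p))) * 2 powr (- p * \<kappa>)"
proof -
  let ?f = "\<lambda>k. min (2 powr (- p * \<kappa>)) (2 powr (- p * real k))"
  define m where "m = nat \<lceil>\<kappa>\<rceil>"
  have m: "\<kappa> \<le> real m" "real m \<le> \<kappa> + 1" using \<kappa> unfolding m_def by linarith+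
  have "sum ?f {k \<in> A. k < m} \<le> (\<Sum>k\<in>{k \<in> A. k < m}. 2 powr (- p * \<kappa>))"
    by (intro sum_mono) simp
  also have "\<dots> \<le> (\<Sum>k\<in>{..<m}. 2 powr (- p * \<kappa>))"
    by (intro sum_mono2) auto
  also have "\<dots> \<le> (\<kappa> + 1) * 2 powr (- p * \<kappa>)" using m by simp
  finally have 1: "sum ?f {k \<in> A. k < m} \<le> (\<kappa> + 1) * 2 powr (- p * \<kappa>)" .
  have "sum ?f {k \<in> A. \<not> k < m} \<le> (\<Sum>k\<in>{k \<in> A. \<not> k < m}. 2 powr (- p * \<kappa>) * 2 powr (- p * real (k - m)))"
  proof (intro sum_mono)
    fix k assume "k \<in> {k \<in> A. \<not> k < m}"
    then have "\<kappa> + real (k - m) \<le> real k" using m by simp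
    then have "p * (\<kappa> + real (k - m)) \<le> p * real k" using p by simp
    then have "2 powr (- p * real k) \<le> 2 powr (- p * \<kappa> + - p * real (k - m))"
      by (intro powr_mono) (auto simp: algebra_simps)
    then show "?f k \<le> 2 powr (- p * \<kappa>) * 2 powr (- p * real (k - m))" unfolding powr_add by simp
  qed
  also have "\<dots> = 2 powr (- p * \<kappa>) * (\<Sum>k\<in>(\<lambda>k. k - m) ` {k \<in> A. \<not> k < m}. 2 powr (- p * real k))"
    unfolding sum_distrib_left by (subst sum.reindex) (auto simp: inj_on_def)
  also have "\<dots> \<le> 2 powr (- p * \<kappa>) * (1 / (1 - 2 powr (- p)))"
    using A p by (intro mult_left_mono sum_powr_neg_le) auto
  finally have 2: "sum ?f {k \<in> A. \<not> k < m} \<le> 2 powr (- p * \<kappa>) * (1 / (1 - 2 powr (- p)))" .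
  have "sum ?f A = sum ?f {k \<in> A. k < m} + sum ?f {k \<in> A. \<not> k < m}"
    using A by (subst sum.union_disjoint[symmetric]) (auto intro!: sum.cong)
  with 1 2 show ?thesis by (simp add: algebra_simps)
qed

text \<open>Each term is the minimum of \<open>t * 2 powr (p * real j)\<close> and
  \<open>2 powr (- (q - p) * real j)\<close>, which yields the power of \<open>t\<close>. For
  \<open>t > 1\<close> the crossing lies at negative \<open>j\<close>, and the bound by a constant,
  from the second sequence alone, takes over.\<close>

lemma sum_shells_le:
  fixes p q :: real
  assumes "0 < p" "p < q"
  shows "\<exists>C>0. \<forall>t>0. \<forall>J. (\<Sum>j<J. 2 powr (p * real j) * min (2 powr (- q * real j)) t)
    \<le> C * min 1 (t powr ((q - p) / q))"
proof -
  define C1 where "C1 = 2 powr min p (q - p) * (2 / (1 - 2 powr (- min p (q - p))))"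
  define C2 where "C2 = 1 / (1 - 2 powr (- (q - p)))"
  have eq: "2 powr (p * real j) * min (2 powr (- q * real j)) t
      = min (t * 2 powr (p * real j)) (2 powr (- (q - p) * real j))" for j t
  proof -
    have "2 powr (p * real j) * 2 powr (- q * real j) = 2 powr (- (q - p) * real j)"
      by (simp add: powr_add[symmetric] algebra_simps)
    then show ?thesis by (simp only: min_mult_distrib_left) (simp add: ac_simps)
  qed
  have "0 < C2" using assms powr_less_mono[of "- (q - p)" 0 2] by (simp add: C2_def)
  moreover have "(\<Sum>j<J. 2 powr (p * real j) * min (2 powr (- q * real j)) t)
    \<le> max C1 C2 * min 1 (t powr ((q - p) / q))" if t: "0 < t" for t J
  proof -
    have "(\<Sum>j<J. 2 powr (p * real j) * min (2 powr (- q * real j)) t) \<le> C1 * t powr ((q - p) / q)"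
      using sum_min_powr_le[of p "q - p" t "{..<J}"] assms t unfolding eq C1_def by simp
    also have "\<dots> \<le> max C1 C2 * t powr ((q - p) / q)" by (intro mult_right_mono) auto
    finally have 1: "(\<Sum>j<J. 2 powr (p * real j) * min (2 powr (- q * real j)) t) \<le> \<dots>" .
    have "(\<Sum>j<J. 2 powr (p * real j) * min (2 powr (- q * real j)) t) \<le> (\<Sum>j<J. 2 powr (- (q - p) * real j))"
      unfolding eq by (intro sum_mono) simp
    also have "\<dots> \<le> C2" unfolding C2_def using assms by (intro sum_powr_neg_le) auto
    finally have "(\<Sum>j<J. 2 powr (p * real j) * min (2 powr (- q * real j)) t) \<le> max C1 C2" by simp
    with 1 show ?thesis by (auto simp: min_def)
  qed
  ultimately show ?thesis by (intro exI[of _ "max C1 C2"]) (auto simp: max.strict_coboundedI2)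
qed

text \<open>The sign of \<open>d * s - p\<close> decides which level dominates: level 0 when
  negative, giving \<open>real N powr (- s)\<close>, and the level where
  \<open>2 powr (d * k)\<close> reaches \<open>N\<close> when positive, giving
  \<open>real N powr (- p / d)\<close>. At zero all levels in between contribute equally.\<close>

lemma sum_levels_le:
  fixes p s d :: real
  assumes p: "0 < p" and s: "0 < s" and d: "0 < d"
  shows "\<exists>C>0. \<forall>N::nat. N \<ge> 1 \<longrightarrow> (\<forall>A. finite A \<longrightarrow>
    (\<Sum>k\<in>A. 2 powr (- p * real k) * min 1 ((2 powr (d * real k) / real N) powr s))
    \<le> C * (if d * s = p then real N powr (- p / d) * ln (1 + real N)
            else max (real N powr (- s)) (real N powr (- p / d))))"
proof -
  have eq: "2 powr (- p * real k) * min 1 ((2 powr (d * real k) / real N) powr s)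
      = min (real N powr (- s) * 2 powr ((d * s - p) * real k)) (2 powr (- p * real k))"
    if "N \<ge> 1" for N k :: nat
  proof -
    have "2 powr (- p * real k) * (2 powr (d * real k) / real N) powr s
        = real N powr (- s) * (2 powr (d * real k * s) * 2 powr (- p * real k))"
      by (simp add: powr_divide powr_powr powr_minus divide_simps)
    also have "\<dots> = real N powr (- s) * 2 powr ((d * s - p) * real k)"
      by (simp add: powr_add[symmetric] algebra_simps)
    finally show ?thesis by (simp only: min_mult_distrib_left) (simp add: min.commute)
  qed
  consider "d * s < p" | "d * s > p" | "d * s = p" by linarith
  then show ?thesis
  proof cases
    case 1
    define C where "C = 1 / (1 - 2 powr (- (p - d * s)))"
    have "0 < C" using 1 powr_less_mono[of "- (p - d * s)" 0 2] by (simp add: C_def)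
    moreover have "(\<Sum>k\<in>A. 2 powr (- p * real k) * min 1 ((2 powr (d * real k) / real N) powr s))
        \<le> C * max (real N powr (- s)) (real N powr (- p / d))" if N: "N \<ge> 1" and A: "finite A" for N A
    proof -
      have "(\<Sum>k\<in>A. 2 powr (- p * real k) * min 1 ((2 powr (d * real k) / real N) powr s))
        \<le> (\<Sum>k\<in>A. real N powr (- s) * 2 powr (- (p - d * s) * real k))"
        unfolding eq[OF N] by (intro sum_mono) simp
      also have "\<dots> \<le> real N powr (- s) * C"
        unfolding sum_distrib_left[symmetric] C_def using 1 A by (intro mult_left_mono sum_powr_neg_le) auto
      also have "\<dots> \<le> C * max (real N powr (- s)) (real N powr (- p / d))"
        using \<open>0 < C\<close> by (simp add: mult.commute)
      finally show ?thesis .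
    qed
    ultimately show ?thesis using 1 by auto
  next
    case 2
    define a where "a = d * s - p"
    define C where "C = 2 powr min a p * (2 / (1 - 2 powr (- min a p)))"
    have a: "0 < a" using 2 by (simp add: a_def)
    have "0 < C" using a p powr_less_mono[of "- min a p" 0 2] by (simp add: C_def)
    moreover have "(\<Sum>k\<in>A. 2 powr (- p * real k) * min 1 ((2 powr (d * real k) / real N) powr s))
        \<le> C * max (real N powr (- s)) (real N powr (- p / d))" if N: "N \<ge> 1" and A: "finite A" for N A
    proof -
      have "(\<Sum>k\<in>A. 2 powr (- p * real k) * min 1 ((2 powr (d * real k) / real N) powr s))
        \<le> C * (real N powr (- s)) powr (p / (a + p))"
        unfolding eq[OF N] C_def a_def[symmetric] using a p A N by (intro sum_min_powr_le) auto
      also have "(real N powr (- s)) powr (p / (a + p)) = real N powr (- p / d)"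
        using s d by (simp add: powr_powr a_def)
      also have "C * \<dots> \<le> C * max (real N powr (- s)) (real N powr (- p / d))"
        using \<open>0 < C\<close> by simp
      finally show ?thesis .
    qed
    ultimately show ?thesis using 2 by auto
  next
    case 3
    define L where "L = ln (2::real)"
    have L: "0 < L" by (simp add: L_def)
    define C0 where "C0 = 1 + 1 / (1 - 2 powr (- p))"
    have C0: "0 < C0" using p powr_less_mono[of "- p" 0 2] by (simp add: C0_def add_pos_pos)
    \<comment> \<open>Since \<open>L \<le> ln (1 + real N)\<close>, the logarithm absorbs the
      constant \<open>C0\<close>; \<open>ln (real N)\<close> could not do so at
      \<open>N = 1\<close>.\<close>
    define C where "C = 1 / (L * d) + C0 / L"
    have "0 < C" using L d C0 by (simp add: C_def add_pos_pos)
    moreover have "(\<Sum>k\<in>A. 2 powr (- p * real k) * min 1 ((2 powr (d * real k) / real N) powr s))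
        \<le> C * (real N powr (- p / d) * ln (1 + real N))" if N: "N \<ge> 1" and A: "finite A" for N A
    proof -
      \<comment> \<open>The level with \<open>2 powr (d * \<kappa>) = real N\<close>.\<close>
      define \<kappa> where "\<kappa> = ln (real N) / (L * d)"
      have \<kappa>: "0 \<le> \<kappa>" using N L d by (simp add: \<kappa>_def)
      have "s = p / d" using 3 d by (simp add: field_simps)
      have pow: "2 powr (- p * \<kappa>) = real N powr (- p / d)"
        using N L d by (simp add: \<kappa>_def powr_def L_def)
      have "(\<Sum>k\<in>A. 2 powr (- p * real k) * min 1 ((2 powr (d * real k) / real N) powr s))
        = (\<Sum>k\<in>A. min (2 powr (- p * \<kappa>)) (2 powr (- p * real k)))"
        unfolding eq[OF N] pow using 3 \<open>s = p / d\<close> by simp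
      also have "\<dots> \<le> (\<kappa> + 1 + 1 / (1 - 2 powr (- p))) * 2 powr (- p * \<kappa>)"
        by (rule sum_min_const_powr_le[OF p \<kappa> A])
      also have "\<kappa> + 1 + 1 / (1 - 2 powr (- p)) = \<kappa> + C0" by (simp add: C0_def)
      also have "(\<kappa> + C0) * 2 powr (- p * \<kappa>) \<le> (C * ln (1 + real N)) * 2 powr (- p * \<kappa>)"
      proof (intro mult_right_mono)
        have "ln (real N) \<le> ln (1 + real N)" using N by simp
        then have "\<kappa> \<le> 1 / (L * d) * ln (1 + real N)" using L d by (simp add: \<kappa>_def divide_right_mono)
        moreover have "L \<le> ln (1 + real N)" using N by (simp add: L_def)
        then have "C0 / L * L \<le> C0 / L * ln (1 + real N)" using C0 L by (intro mult_left_mono) auto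
        ultimately show "\<kappa> + C0 \<le> C * ln (1 + real N)" using L by (simp add: C_def distrib_right)
      qed simp
      finally show ?thesis unfolding pow by (simp only: ac_simps)
    qed
    ultimately show ?thesis using 3 by auto
  qed
qed

text \<open>With \<open>s = 1 - p / q\<close>, the \<open>p\<close>-th power of the rate in the theorem.\<close>

definition scale_rate :: "real \<Rightarrow> real \<Rightarrow> real \<Rightarrow> nat \<Rightarrow> real" where
  "scale_rate d s p N = (if d * s = p then real N powr (- p / d) * ln (1 + real N)
     else max (real N powr (- s)) (real N powr (- p / d)))"

text \<open>This absorbs the remainder left by the finite depth of the code. The factor
  \<open>1 / ln 2\<close> comes from the critical case, where \<open>ln (1 + real N)\<close> is at
  least \<open>ln 2\<close>.\<close>

lemma powr_le_scale_rate:
  assumes "1 \<le> N"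
  shows "real N powr (- p / d) \<le> 1 / ln 2 * scale_rate d s p N"
proof -
  have ln2: "0 < ln (2::real)" "ln (2::real) \<le> 1" using ln_le_minus_one[of "2::real"] by simp_all
  have "ln 2 * real N powr (- p / d) \<le> scale_rate d s p N"
  proof (cases "d * s = p")
    case True
    have "ln 2 * real N powr (- p / d) \<le> ln (1 + real N) * real N powr (- p / d)"
      using assms by (intro mult_right_mono) auto
    then show ?thesis using True by (simp add: scale_rate_def mult.commute)
  next
    case False
    have "ln 2 * real N powr (- p / d) \<le> 1 * real N powr (- p / d)"
      using ln2 by (intro mult_right_mono) auto
    also have "\<dots> \<le> scale_rate d s p N" using False by (simp add: scale_rate_def)
    finally show ?thesis .
  qed
  then show ?thesis using ln2(1) by (simp add: pos_le_divide_eq mult.commute)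
qed

text \<open>The shells are summed inside, for each fixed level \<open>k\<close>, with
  \<open>t = 2 powr (d * real k) / real N\<close>; the levels come afterwards.\<close>

lemma sum_scales_le:
  fixes p q d :: real
  assumes p: "0 < p" and q: "p < q" and d: "1 \<le> d"
  shows "\<exists>C>0. \<forall>N J::nat. N \<ge> 1 \<longrightarrow>
    (\<Sum>j<J. (\<Sum>k\<le>N. 2 powr (p * (real j - real k)) * min (2 powr (- q * real j)) (2 powr (d * real k) / real N))
       + 2 powr (p * (real j - real (Suc N))) * 2 powr (- q * real j))
    \<le> C * scale_rate d ((q - p) / q) p N"
proof -
  let ?s = "(q - p) / q"
  have s: "0 < ?s" using p q by simp
  from sum_shells_le[OF p q] obtain C1 where C1: "0 < C1"
    and shells: "\<And>t J. 0 < t \<Longrightarrow> (\<Sum>j<J. 2 powr (p * real j) * min (2 powr (- q * real j)) t) \<le> C1 * min 1 (t powr ?s)"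
    by blast
  from d have "0 < d" by simp
  from sum_levels_le[OF p s this] obtain C2 where C2: "0 < C2"
    and levels: "\<And>N A. N \<ge> 1 \<Longrightarrow> finite A \<Longrightarrow>
      (\<Sum>k\<in>A. 2 powr (- p * real k) * min 1 ((2 powr (d * real k) / real N) powr ?s)) \<le> C2 * scale_rate d ?s p N"
    unfolding scale_rate_def by blast
  define C where "C = C1 * C2 + C1 / ln 2"
  have "0 < C" using C1 C2 by (simp add: C_def add_pos_pos)
  moreover have "(\<Sum>j<J. (\<Sum>k\<le>N. 2 powr (p * (real j - real k)) * min (2 powr (- q * real j)) (2 powr (d * real k) / real N))
       + 2 powr (p * (real j - real (Suc N))) * 2 powr (- q * real j))
    \<le> C * scale_rate d ?s p N" if N: "N \<ge> 1" for N J :: nat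
  proof -
    have split: "2 powr (p * (real j - real k)) = 2 powr (- p * real k) * 2 powr (p * real j)" for j k
      by (simp add: powr_add[symmetric] algebra_simps)
    have "(\<Sum>j<J. \<Sum>k\<le>N. 2 powr (p * (real j - real k)) * min (2 powr (- q * real j)) (2 powr (d * real k) / real N))
      = (\<Sum>k\<le>N. 2 powr (- p * real k) * (\<Sum>j<J. 2 powr (p * real j) * min (2 powr (- q * real j)) (2 powr (d * real k) / real N)))"
      unfolding split sum_distrib_left mult.assoc by (rule sum.swap)
    also have "\<dots> \<le> (\<Sum>k\<le>N. 2 powr (- p * real k) * (C1 * min 1 ((2 powr (d * real k) / real N) powr ?s)))"
      using N by (intro sum_mono mult_left_mono shells) auto
    also have "\<dots> = C1 * (\<Sum>k\<le>N. 2 powr (- p * real k) * min 1 ((2 powr (d * real k) / real N) powr ?s))"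
      unfolding sum_distrib_left by (simp only: ac_simps)
    also have "\<dots> \<le> C1 * (C2 * scale_rate d ?s p N)"
      using C1 N by (intro mult_left_mono levels) auto
    finally have main: "(\<Sum>j<J. \<Sum>k\<le>N. 2 powr (p * (real j - real k)) * min (2 powr (- q * real j)) (2 powr (d * real k) / real N))
      \<le> C1 * C2 * scale_rate d ?s p N" by (simp only: mult.assoc)
    \<comment> \<open>The finest-level term is the shell sum at \<open>t = 1\<close>, where the
      minimum is its first entry.\<close>
    have "(\<Sum>j<J. 2 powr (p * (real j - real (Suc N))) * 2 powr (- q * real j))
       = 2 powr (- p * real (Suc N)) * (\<Sum>j<J. 2 powr (p * real j) * min (2 powr (- q * real j)) 1)"
    proof -
      have "min (2 powr (- q * real j)) 1 = (2::real) powr (- q * real j)" for j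
      proof (rule min_absorb1)
        have "(2::real) powr (- q * real j) \<le> 2 powr 0" using p q by (intro powr_mono) auto
        then show "(2::real) powr (- q * real j) \<le> 1" by simp
      qed
      then show ?thesis unfolding split sum_distrib_left by (simp only: mult.assoc)
    qed
    also have "\<dots> \<le> 2 powr (- p * real (Suc N)) * C1"
      using shells[of 1 J] by (intro mult_left_mono) auto
    finally have tail: "(\<Sum>j<J. 2 powr (p * (real j - real (Suc N))) * 2 powr (- q * real j))
       \<le> 2 powr (- p * real (Suc N)) * C1" .
    \<comment> \<open>Depth \<open>N\<close> is enough because \<open>N \<le> 2 ^ N\<close> and
      \<open>d \<ge> 1\<close>.\<close>
    have "2 powr (- p * real (Suc N)) \<le> real N powr (- p / d)"
    proof -
      have "real N \<le> 2 powr real (Suc N)"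
      proof -
        have "real N \<le> 2 ^ N" using of_nat_less_two_power[of N, where 'a = real] by simp
        also have "\<dots> = 2 powr real N" by (simp add: powr_realpow)
        also have "\<dots> \<le> 2 powr real (Suc N)" by (intro powr_mono) auto
        finally show ?thesis .
      qed
      then have "real N powr (p / d) \<le> (2 powr real (Suc N)) powr (p / d)"
        using p d by (intro powr_mono2) auto
      also have "\<dots> = 2 powr (real (Suc N) * (p / d))" by (rule powr_powr)
      also have "\<dots> \<le> 2 powr (real (Suc N) * p)"
        using p d by (intro powr_mono mult_left_mono) (simp_all add: divide_le_eq)
      finally have "inverse (2 powr (real (Suc N) * p)) \<le> inverse (real N powr (p / d))"
        using N by (intro le_imp_inverse_le) auto
      then show ?thesis unfolding powr_minus[symmetric] minus_mult_right[symmetric]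
        by (simp only: minus_divide_left minus_mult_left mult.commute)
    qed
    also have "real N powr (- p / d) \<le> 1 / ln 2 * scale_rate d ?s p N" by (rule powr_le_scale_rate[OF N])
    finally have "2 powr (- p * real (Suc N)) * C1 \<le> (1 / ln 2 * scale_rate d ?s p N) * C1"
      using C1 by (intro mult_right_mono) auto
    with tail have "(\<Sum>j<J. 2 powr (p * (real j - real (Suc N))) * 2 powr (- q * real j))
       \<le> C1 / ln 2 * scale_rate d ?s p N" by (simp add: mult.commute)
    with main show ?thesis unfolding C_def sum.distrib distrib_right by (rule add_mono)
  qed
  ultimately show ?thesis by blast
qed

section \<open>The quantization bound at scale R and the choice of R\<close>

lemma ennreal_powr_mono: "x \<le> y \<Longrightarrow> 0 \<le> a \<Longrightarrow> ennreal_powr x a \<le> ennreal_powr y a"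
  unfolding ennreal_powr_def
  by (auto simp: top_unique less_top intro!: ennreal_leI powr_mono2 enn2real_mono)

text \<open>Shell \<open>j\<close> begins at radius \<open>R * 2 ^ (j - 1)\<close>, and this shift
  by one costs the factor \<open>2 powr q\<close>. Shell 0 has no lower radius; its mass is at most
  1.\<close>

lemma measure_shell_le:
  fixes \<mu> :: "(real ^ 'n) measure"
  assumes \<mu>: "\<mu> \<in> borel_probs" and R: "0 < R" and q: "0 < q"
    and W: "weak_moment q \<mu> \<le> ennreal (R powr q)"
  shows "measure \<mu> {x. shell R x = j} \<le> 2 powr q * 2 powr (- q * real j)"
proof -
  interpret prob_space \<mu> using \<mu> by (simp add: borel_probs_def)
  have [simp, measurable_cong]: "sets \<mu> = sets borel" using \<mu> by (simp add: borel_probs_def)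
  show ?thesis
  proof (cases j)
    case 0
    have "measure \<mu> {x. shell R x = j} \<le> 1" by simp
    also have "(1::real) \<le> 2 powr q" using q powr_mono[of 0 q 2] by simp
    finally show ?thesis using 0 by simp
  next
    case (Suc i)
    let ?r = "R * 2 ^ i"
    have r: "0 < ?r" using R by simp
    have "ennreal (?r powr q) * emeasure \<mu> {x. ?r \<le> norm x} \<le> weak_moment q \<mu>"
      unfolding weak_moment_def using r by (intro SUP_upper) auto
    with W have "ennreal (?r powr q) * emeasure \<mu> {x. ?r \<le> norm x} \<le> ennreal (R powr q)" by simp
    then have "?r powr q * measure \<mu> {x. ?r \<le> norm x} \<le> R powr q"
      by (simp add: emeasure_eq_measure ennreal_mult[symmetric])
    moreover have "?r powr q = R powr q * 2 powr (q * real i)"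
      using R by (simp add: powr_mult powr_powr mult.commute flip: powr_realpow)
    ultimately have "2 powr (q * real i) * measure \<mu> {x. ?r \<le> norm x} \<le> 1"
      using R by (simp add: mult.assoc)
    then have "measure \<mu> {x. ?r \<le> norm x} \<le> 2 powr (- (q * real i))"
      by (simp add: powr_minus field_simps)
    moreover have "measure \<mu> {x. shell R x = j} \<le> measure \<mu> {x. ?r \<le> norm x}"
      using shell_Suc_le_norm Suc by (intro finite_measure_mono) auto
    moreover have "2 powr q * 2 powr (- q * real j) = 2 powr (- (q * real i))"
      using Suc by (simp add: powr_add[symmetric] algebra_simps)
    ultimately show ?thesis by simp
  qed
qed

lemma quantization_error_le_suminf:
  fixes \<mu> :: "(real ^ 'n) measure"
  assumes \<mu>: "\<mu> \<in> borel_probs" and R: "0 < R" and p: "0 < p" and q: "0 < q" and N: "1 \<le> N"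
    and W: "weak_moment q \<mu> \<le> ennreal (R powr q)"
  shows "quantization_error N p \<mu> \<le> ennreal_powr (\<Sum>j. ennreal ((4 * real CARD('n) * R) powr p * 2 powr (q + 1) *
    ((\<Sum>k\<le>N. 2 powr (p * (real j - real k)) * min (2 powr (- q * real j)) (2 powr (real CARD('n) * real k) / real N))
       + 2 powr (p * (real j - real (Suc N))) * 2 powr (- q * real j)))) (1 / p)"
proof -
  interpret prob_space \<mu> using \<mu> by (simp add: borel_probs_def)
  have sets_\<mu>[simp, measurable_cong]: "sets \<mu> = sets borel" using \<mu> by (simp add: borel_probs_def)
  then have space_\<mu>[simp]: "space \<mu> = UNIV" using sets_eq_imp_space_eq[of \<mu> borel] by simp
  interpret coded_prob_space \<mu> "cell_code R N" N
    using N by unfold_locales auto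
  let ?d = "real CARD('n)" and ?B = "2 ^ CARD('n) :: nat"
  have d: "1 \<le> ?d" using zero_less_card_finite[where 'a = 'n] by simp
  define c where "c = (4 * ?d * R) powr p"
  \<comment> \<open>The factor 4 in \<open>c\<close> is the 2 of the side length, doubled by the
    index shift: \<open>a (Suc k)\<close> must dominate the diameter at level
    \<open>k\<close>.\<close>
  define a where "a k j = c * 2 powr (p * (real j - real k))" for k j :: nat
  define \<delta> where "\<delta> x y = norm (x - y) powr p" for x y :: "real ^ 'n"
  have a_eq: "a k j = (4 * ?d * R * 2 ^ j / 2 ^ k) powr p" for k j
  proof -
    have "2 ^ j / 2 ^ k = (2::real) powr (real j - real k)" by (simp add: powr_diff powr_realpow)
    then have "(4 * ?d * R * 2 ^ j / 2 ^ k) powr p = (4 * ?d * R * 2 powr (real j - real k)) powr p"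
      by (metis times_divide_eq_right)
    also have "\<dots> = a k j" using R by (simp add: powr_mult powr_powr a_def c_def mult.commute)
    finally show ?thesis by simp
  qed
  have shell: "cell_code R N x div ?B ^ N = shell R x" for x :: "real ^ 'n"
    using cell_code_div[of 0 N R x] by simp
  obtain X where X: "\<forall>l\<in>{1..N}. X l \<in> space \<mu> \<and> cell_code R N (X l) = first_code l"
    using exists_first_point by blast
  have root: "\<delta> x y \<le> a 0 (cell_code R N x div ?B ^ N)" if "cell_code R N y \<le> cell_code R N x" for x y
  proof -
    \<comment> \<open>The shell is the leading part of the code, so the order of codes respects
      it.\<close>
    have "shell R y \<le> shell R x" using div_le_mono[OF that, of "?B ^ N"] shell by simp
    then have "R * 2 ^ shell R y \<le> R * 2 ^ shell R x" using R by (simp add: power_increasing)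
    then have "norm (x - y) \<le> 2 * (R * 2 ^ shell R x)"
      using norm_less_shell[OF R, of x] norm_less_shell[OF R, of y] norm_triangle_ineq4[of x y] by linarith
    also have "\<dots> \<le> (4 * ?d) * (R * 2 ^ shell R x)"
    proof (rule mult_right_mono)
      show "2 \<le> 4 * ?d" using d by linarith
    qed (use R in simp)
    also have "\<dots> = 4 * ?d * R * 2 ^ shell R x / 2 ^ 0" by simp
    finally show ?thesis unfolding \<delta>_def a_eq shell using p by (intro powr_mono2) auto
  qed
  have cell: "\<delta> x y \<le> a (Suc k) (cell_code R N x div ?B ^ N)"
    if "k \<le> N" "cell_code R N x div ?B ^ (N - k) = cell_code R N y div ?B ^ (N - k)" for x y k
  proof -
    have "cell_code R k x = cell_code R k y" using that(2) unfolding cell_code_div[OF that(1)] .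
    from cell_code_eq_imp_norm_diff_le[OF R this]
    have "norm (x - y) \<le> 4 * ?d * R * 2 ^ shell R x / 2 ^ Suc k" by (simp add: ac_simps)
    then show ?thesis unfolding \<delta>_def a_eq shell using p by (intro powr_mono2) auto
  qed
  have a_nonneg: "0 \<le> a k j" for k j by (simp add: a_def c_def)
  let ?P = "\<lambda>j. prob {x. shell R x = j}"
  have P: "?P j \<le> 2 powr q * 2 powr (- q * real j)" for j
    by (rule measure_shell_le[OF \<mu> R q W])
  \<comment> \<open>A single constant covers both the \<open>2 powr q\<close> of the shell masses
    and the 2 from the two split pieces.\<close>
  have le: "2 powr q \<le> (2::real) powr (q + 1)" "2 \<le> (2::real) powr (q + 1)"
    using q powr_mono[of 1 "q + 1" 2] by simp_all
  have P1: "?P j \<le> 2 powr (q + 1) * 2 powr (- q * real j)" for j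
    by (rule order_trans[OF P mult_right_mono[OF le(1)]]) simp
  have P2: "min (?P j) (2 * real ?B ^ k / real N)
      \<le> 2 powr (q + 1) * min (2 powr (- q * real j)) (2 powr (?d * real k) / real N)" for j k
  proof -
    have "2 * real ?B ^ k / real N = 2 * (2 powr (?d * real k) / real N)"
      by (simp add: powr_realpow power_mult flip: of_nat_mult)
    also have "\<dots> \<le> 2 powr (q + 1) * (2 powr (?d * real k) / real N)"
      using le by (intro mult_right_mono) auto
    finally show ?thesis using P1[of j] by (simp add: min_mult_distrib_left) linarith
  qed
  have "quantization_error N p \<mu> \<le> wasserstein p \<mu> (empirical N X)"
    unfolding quantization_error_def by (rule INF_lower) simp
  also have "\<dots> \<le> ennreal_powr (\<Sum>l=1..N. \<integral>\<^sup>+ x. ennreal (plan l x) * ennreal (norm (x - X l) powr p) \<partial>\<mu>) (1 / p)"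
    using \<mu> N plan_measurable plan_sum plan_integral by (intro wasserstein_le_plan) auto
  also have "\<dots> = ennreal_powr (\<Sum>l=1..N. \<integral>\<^sup>+ x. ennreal (plan l x * \<delta> x (X l)) \<partial>\<mu>) (1 / p)"
    by (simp add: \<delta>_def ennreal_mult plan_nonneg)
  also have "\<dots> \<le> ennreal_powr (\<Sum>j. ennreal ((\<Sum>k\<le>N. a k j * min (prob {x \<in> space \<mu>. cell_code R N x div ?B ^ N = j}) (2 * real ?B ^ k / real N))
      + a (Suc N) j * prob {x \<in> space \<mu>. cell_code R N x div ?B ^ N = j})) (1 / p)"
    using p X by (intro ennreal_powr_mono plan_cost_le a_nonneg root cell) auto
  also have "\<dots> \<le> ennreal_powr (\<Sum>j. ennreal (c * 2 powr (q + 1) *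
    ((\<Sum>k\<le>N. 2 powr (p * (real j - real k)) * min (2 powr (- q * real j)) (2 powr (?d * real k) / real N))
       + 2 powr (p * (real j - real (Suc N))) * 2 powr (- q * real j)))) (1 / p)"
  proof (intro ennreal_powr_mono suminf_le summableI ennreal_leI)
    fix j
    have "(\<Sum>k\<le>N. a k j * min (?P j) (2 * real ?B ^ k / real N)) + a (Suc N) j * ?P j
      \<le> (\<Sum>k\<le>N. a k j * (2 powr (q + 1) * min (2 powr (- q * real j)) (2 powr (?d * real k) / real N)))
        + a (Suc N) j * (2 powr (q + 1) * 2 powr (- q * real j))"
      by (intro add_mono sum_mono mult_left_mono P1 P2 a_nonneg)
    also have "\<dots> = c * 2 powr (q + 1) *
    ((\<Sum>k\<le>N. 2 powr (p * (real j - real k)) * min (2 powr (- q * real j)) (2 powr (?d * real k) / real N))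
       + 2 powr (p * (real j - real (Suc N))) * 2 powr (- q * real j))"
      unfolding a_def distrib_left sum_distrib_left by (simp only: ac_simps)
    finally show "(\<Sum>k\<le>N. a k j * min (prob {x \<in> space \<mu>. cell_code R N x div ?B ^ N = j}) (2 * real ?B ^ k / real N))
      + a (Suc N) j * prob {x \<in> space \<mu>. cell_code R N x div ?B ^ N = j} \<le> c * 2 powr (q + 1) *
    ((\<Sum>k\<le>N. 2 powr (p * (real j - real k)) * min (2 powr (- q * real j)) (2 powr (?d * real k) / real N))
       + 2 powr (p * (real j - real (Suc N))) * 2 powr (- q * real j))"
      by (simp only: shell space_\<mu> UNIV_I simp_thms)
  qed (use p in simp)
  finally show ?thesis unfolding c_def .
qed

lemma scale_rate_powr:
  fixes p q d :: real
  assumes p: "0 < p" and q: "p < q" and d: "1 \<le> d" and N: "1 \<le> N"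
  shows "scale_rate d ((q - p) / q) p N powr (1 / p) =
    (if d \<noteq> p * q / (q - p)
     then max (real N powr (- 1 / p + 1 / q)) (real N powr (- 1 / d))
     else real N powr (- 1 / d) * (ln (1 + real N)) powr (1 / p))"
proof -
  have critical: "d * ((q - p) / q) = p \<longleftrightarrow> d = p * q / (q - p)"
    using p q by (auto simp: field_simps)
  have dim: "(real N powr (- p / d)) powr (1 / p) = real N powr (- 1 / d)"
    using p by (simp add: powr_powr)
  have "- ((q - p) / q) * (1 / p) = - 1 / p + 1 / q" using p q by (simp add: field_simps)
  then have tail: "(real N powr (- ((q - p) / q))) powr (1 / p) = real N powr (- 1 / p + 1 / q)"
    by (simp only: powr_powr)
  have max_powr: "max x y powr (1 / p) = max (x powr (1 / p)) (y powr (1 / p))" if "0 \<le> x" "0 \<le> y" for x y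
    using that p powr_mono2[of "1 / p" x y] powr_mono2[of "1 / p" y x] by (auto simp: max_def)
  show ?thesis
  proof (cases "d = p * q / (q - p)")
    case True
    have "(real N powr (- p / d) * ln (1 + real N)) powr (1 / p) =
        (real N powr (- p / d)) powr (1 / p) * (ln (1 + real N)) powr (1 / p)"
      by (simp add: powr_mult)
    with True show ?thesis unfolding scale_rate_def critical dim by simp
  next
    case False
    then show ?thesis
      unfolding scale_rate_def critical by (simp only: if_False max_powr powr_ge_zero dim tail) simp
  qed
qed

theorem theorem1p2:
  fixes p q :: real
  assumes "0 < p" and "p < q"
  shows "\<exists>C::real. C > 0 \<and>
    (\<forall>N::nat. N \<ge> 1 \<longrightarrow>
      (\<forall>\<mu> \<in> (weak_probs q :: (real ^ 'n) measure set).
        quantization_error N p \<mu> \<le>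
          ennreal C * ennreal_powr (weak_moment q \<mu>) (1 / q) *
          ennreal (if real CARD('n) \<noteq> p * q / (q - p)
            then max (real N powr (- 1 / p + 1 / q)) (real N powr (- 1 / real CARD('n)))
            else real N powr (- 1 / real CARD('n)) * (ln (1 + real N)) powr (1 / p))))"
proof -
  note p = assms(1) and q = assms(2)
  let ?d = "real CARD('n)" and ?s = "(q - p) / q"
  have d: "1 \<le> ?d" using zero_less_card_finite[where 'a = 'n] by simp
  obtain C0 where C0: "0 < C0" and scales: "\<And>N J::nat. N \<ge> 1 \<Longrightarrow>
    (\<Sum>j<J. (\<Sum>k\<le>N. 2 powr (p * (real j - real k)) * min (2 powr (- q * real j)) (2 powr (?d * real k) / real N))
       + 2 powr (p * (real j - real (Suc N))) * 2 powr (- q * real j))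
    \<le> C0 * scale_rate ?d ?s p N"
    using sum_scales_le[OF p q d] by blast
  \<comment> \<open>\<open>C * R\<close> is the \<open>p\<close>-th root of
    \<open>(4 * ?d * R) powr p * 2 powr (q + 1) * C0\<close>.\<close>
  define C where "C = 4 * ?d * (2 powr (q + 1) * C0) powr (1 / p)"
  have C: "0 < C" using C0 d by (simp add: C_def)
  \<comment> \<open>The bound is linear in \<open>R\<close>, so \<open>R\<close> can afterwards
    approach the \<open>q\<close>-th root of the weak moment.\<close>
  have bound: "quantization_error N p \<mu> \<le> ennreal (C * R * scale_rate ?d ?s p N powr (1 / p))"
    if \<mu>: "\<mu> \<in> borel_probs" and R: "0 < R" and N: "1 \<le> N" and W: "weak_moment q \<mu> \<le> ennreal (R powr q)"
    for \<mu> :: "(real ^ 'n) measure" and R N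
  proof -
    let ?r = "scale_rate ?d ?s p N"
    define c where "c = (4 * ?d * R) powr p * 2 powr (q + 1)"
    define u where "u j = (\<Sum>k\<le>N. 2 powr (p * (real j - real k)) * min (2 powr (- q * real j)) (2 powr (?d * real k) / real N))
       + 2 powr (p * (real j - real (Suc N))) * 2 powr (- q * real j)" for j
    have r: "0 \<le> ?r" using N by (auto simp: scale_rate_def le_max_iff_disj)
    have c: "0 \<le> c" by (simp add: c_def)
    have u: "0 \<le> u j" for j unfolding u_def by (intro add_nonneg_nonneg sum_nonneg) auto
    have "quantization_error N p \<mu> \<le> ennreal_powr (\<Sum>j. ennreal (c * u j)) (1 / p)"
      unfolding c_def u_def using p q by (intro quantization_error_le_suminf \<mu> R N W) auto
    also have "\<dots> \<le> ennreal_powr (ennreal (c * (C0 * ?r))) (1 / p)"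
    \<comment> \<open>The estimate over shells is uniform in the number \<open>J\<close> of shells,
      hence passes to the infinite series.\<close>
    proof (intro ennreal_powr_mono suminf_le_const summableI)
      fix J
      have "(\<Sum>j<J. ennreal (c * u j)) = ennreal (c * (\<Sum>j<J. u j))"
        using c u by (simp add: sum_ennreal sum_distrib_left)
      also have "\<dots> \<le> ennreal (c * (C0 * ?r))"
        unfolding u_def by (intro ennreal_leI mult_left_mono scales N c)
      finally show "(\<Sum>j<J. ennreal (c * u j)) \<le> ennreal (c * (C0 * ?r))" .
    qed (use p in simp)
    also have "\<dots> = ennreal ((c * (C0 * ?r)) powr (1 / p))"
      using c C0 r by (simp add: ennreal_powr_def)
    also have "(c * (C0 * ?r)) powr (1 / p) = C * R * ?r powr (1 / p)"
      using p R C0 r d by (simp add: c_def C_def powr_mult powr_powr)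
    finally show ?thesis .
  qed
  show ?thesis
  proof (intro exI[of _ C] conjI allI impI ballI C)
    fix N :: nat and \<mu> :: "(real ^ 'n) measure"
    assume N: "1 \<le> N" and "\<mu> \<in> weak_probs q"
    then have \<mu>: "\<mu> \<in> borel_probs" and fin: "weak_moment q \<mu> < \<infinity>" by (auto simp: weak_probs_def)
    define m where "m = enn2real (weak_moment q \<mu>)"
    have m: "weak_moment q \<mu> = ennreal m" "0 \<le> m" using fin by (simp_all add: m_def)
    define T where "T = scale_rate ?d ?s p N powr (1 / p)"
    have T: "0 < T"
      using powr_le_scale_rate[OF N, of p ?d ?s] N less_le_trans[of 0 "real N powr (- p / ?d)"]
      by (auto simp: T_def zero_less_divide_iff)
    have "quantization_error N p \<mu> \<le> ennreal (C * m powr (1 / q) * T)"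
    proof (rule ennreal_le_epsilon)
      fix e :: real assume e: "0 < e"
      \<comment> \<open>The scale must be positive also when the weak moment vanishes.\<close>
      define R where "R = m powr (1 / q) + e / (C * T)"
      have R: "0 < R" "m powr (1 / q) \<le> R" using e C T by (simp_all add: R_def add_nonneg_pos)
      have "m = (m powr (1 / q)) powr q" using p q m by (simp add: powr_powr)
      also have "\<dots> \<le> R powr q" using R p q by (intro powr_mono2) auto
      finally have "quantization_error N p \<mu> \<le> ennreal (C * R * T)"
        unfolding T_def using m by (intro bound[OF \<mu> R(1) N]) (simp add: ennreal_leI)
      also have "C * R * T = C * m powr (1 / q) * T + e"
        using C T by (simp add: R_def field_simps)
      finally show "quantization_error N p \<mu> \<le> ennreal (C * m powr (1 / q) * T) + ennreal e"
        using C T e by simp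
    qed
    also have "\<dots> = ennreal C * ennreal_powr (weak_moment q \<mu>) (1 / q) * ennreal T"
      using C T m by (simp add: ennreal_powr_def ennreal_mult)
    finally show "quantization_error N p \<mu> \<le>
          ennreal C * ennreal_powr (weak_moment q \<mu>) (1 / q) *
          ennreal (if ?d \<noteq> p * q / (q - p)
            then max (real N powr (- 1 / p + 1 / q)) (real N powr (- 1 / ?d))
            else real N powr (- 1 / ?d) * (ln (1 + real N)) powr (1 / p))"
      unfolding T_def scale_rate_powr[OF p q d N] .
  qed
qed

end
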